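(* Let $\mathcal{D}_n$ be the set of $n\times n$ real diagonal matrices, and let $A$ be a fixed nonnegative $n\times n$ matrix with positive spectral radius. Then: 1. For every $C,D\in\mathcal{D}_n$ and $t\in(0,1)$, $$\log r(e^{(1-t)C+tD}A)\le(1-t)\log r(e^{C}A)+t\log r(e^{D}A).\qquad( * )$$ 2. If $C-D$ is a scalar matrix, then equality holds in $( * )$. 3. The following are equivalent: (a) $A$ and $A^{\top}A$ are irreducible; (b) for all $C,D\in\mathcal{D}_n$ and $t\in(0,1)$, equality holds in $( * )$ only if $C-D$ is a scalar matrix; (c) for all pairs $C,D\in\mathcal{D}_n$ for which $C-D$ is not a scalar matrix, strict inequality holds in $( * )$ (for all $t\in(0,1)$).
   Context: $r(\cdot)$ denotes the spectral radius. A scalar matrix is a matrix of the form $cI$ with $c\in\mathbb{R}$, where $I$ is the identity matrix. An $n\times n$ matrix $A$ is irreducible if $\{1,\dots,n\}$ cannot be partitioned into two nonempty sets $S_1,S_2$ such that $A_{ij}=0$ for all $i\in S_1$, $j\in S_2$. *)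

theory Defs
  imports "Jordan_Normal_Form.Spectral_Radius"
begin

definition real_spectral_radius :: "real mat \<Rightarrow> real" where
  "real_spectral_radius A = spectral_radius (map_mat complex_of_real A)"

definition nonneg_matrix :: "real mat \<Rightarrow> bool" where
  "nonneg_matrix A \<longleftrightarrow> (\<forall>i<dim_row A. \<forall>j<dim_col A. 0 \<le> A $$ (i, j))"

definition diagonal_mats :: "nat \<Rightarrow> real mat set" where
  "diagonal_mats n = {C \<in> carrier_mat n n. diagonal_mat C}"

definition scalar_matrix :: "real mat \<Rightarrow> bool" where
  "scalar_matrix M \<longleftrightarrow> (\<exists>c. M = c \<cdot>\<^sub>m 1\<^sub>m (dim_row M))"

(* Indices are 0-based, so the index set {1,...,n} becomes {..<n}. *)
definition irreducible_matrix :: "real mat \<Rightarrow> bool" where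
  "irreducible_matrix A \<longleftrightarrow>
     \<not> (\<exists>S\<^sub>1 S\<^sub>2. S\<^sub>1 \<noteq> {} \<and> S\<^sub>2 \<noteq> {} \<and> S\<^sub>1 \<inter> S\<^sub>2 = {} \<and> S\<^sub>1 \<union> S\<^sub>2 = {..<dim_row A} \<and>
           (\<forall>i\<in>S\<^sub>1. \<forall>j\<in>S\<^sub>2. A $$ (i, j) = 0))"

(* The matrix exponential, i.e. the power series \<Sum>k. M^k / k!, summed entrywise;
   the type of matrices of all dimensions carries no topology of its own. *)
definition mat_exp :: "real mat \<Rightarrow> real mat" where
  "mat_exp M = mat (dim_row M) (dim_row M) (\<lambda>(i, j). \<Sum>k. (M ^\<^sub>m k) $$ (i, j) / fact k)"

lemma diagonal_mats_pow_index:
  assumes C: "C \<in> diagonal_mats n" and i: "i < n" and j: "j < n"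
  shows "(C ^\<^sub>m k) $$ (i, j) = (if i = j then C $$ (i, i) ^ k else 0)"
  using j
proof (induction k arbitrary: j)
  case 0
  then show ?case using C i by (auto simp: diagonal_mats_def)
next
  case (Suc k)
  have Cc: "C \<in> carrier_mat n n"
    and off: "\<And>l m. l < n \<Longrightarrow> m < n \<Longrightarrow> l \<noteq> m \<Longrightarrow> C $$ (l, m) = 0"
    using C by (auto simp: diagonal_mats_def diagonal_mat_def)
  have P: "C ^\<^sub>m k \<in> carrier_mat n n" using Cc by simp
  have "(C ^\<^sub>m Suc k) $$ (i, j) = (\<Sum>l = 0..<n. (C ^\<^sub>m k) $$ (i, l) * C $$ (l, j))"
    using Cc P i Suc.prems by (simp add: scalar_prod_def)
  also have "\<dots> = (\<Sum>l = 0..<n. if l = i then C $$ (i, i) ^ k * C $$ (i, j) else 0)"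
    by (rule sum.cong) (auto simp: Suc.IH)
  also have "\<dots> = C $$ (i, i) ^ k * C $$ (i, j)"
    using i by simp
  finally show ?case using off i Suc.prems by auto
qed

lemma mat_exp_diagonal:
  assumes C: "C \<in> diagonal_mats n"
  shows "mat_exp C = mat n n (\<lambda>(i, j). if i = j then exp (C $$ (i, i)) else 0)"
proof (rule eq_matI)
  have [simp]: "dim_row C = n" using C by (auto simp: diagonal_mats_def)
  fix i j
  assume "i < dim_row (mat n n (\<lambda>(i, j). if i = j then exp (C $$ (i, i)) else 0))"
    and "j < dim_col (mat n n (\<lambda>(i, j). if i = j then exp (C $$ (i, i)) else 0))"
  then show "mat_exp C $$ (i, j) =
      mat n n (\<lambda>(i, j). if i = j then exp (C $$ (i, i)) else 0) $$ (i, j)"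
    by (simp add: mat_exp_def diagonal_mats_pow_index[OF C] exp_def divide_inverse mult.commute)
qed (use C in \<open>auto simp: mat_exp_def diagonal_mats_def\<close>)

end

theory Submission
  imports Defs
begin

text \<open>For a nonnegative matrix the spectral radius is the infimum of all \<open>\<rho>\<close> that admit a positive
  vector \<open>x\<close> with \<open>A x \<le> \<rho> x\<close>. Given such vectors \<open>x\<close> and \<open>y\<close> for the row scalings \<open>c\<close> and \<open>d\<close>, Hoelder's
  inequality in each row shows that \<open>x\<^bsup>1-t\<^esup> y\<^bsup>t\<^esup>\<close> serves for the scaling \<open>(1-t)c + td\<close>; this is the
  convexity. For irreducible \<open>A\<close> the infimum is attained, by an eigenvector, so equality forces
  equality in Hoelder in each row: the ratio \<open>y j / x j\<close> is then constant on the support of each row,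
  hence constant once \<open>transpose_mat A * A\<close> is irreducible, and the eigenvector equations show that
  \<open>c - d\<close> is constant. If \<open>A\<close> is reducible, scaling one diagonal block makes the logarithm of the radius
  locally affine; if only \<open>transpose_mat A * A\<close> is reducible, some nonconstant row scaling is a
  diagonal similarity.\<close>

section \<open>Positive supersolutions and the spectral radius\<close>

text \<open>The vector is a function on \<open>nat\<close>, so that pointwise powers and
  single-coordinate updates need no dimension bookkeeping; only its values below
  \<open>dim_row A\<close> matter.\<close>

definition positive_supersolution :: "real mat \<Rightarrow> real \<Rightarrow> (nat \<Rightarrow> real) \<Rightarrow> bool" where
  "positive_supersolution A \<rho> x \<longleftrightarrow>
     (\<forall>i<dim_row A. 0 < x i \<and> (\<Sum>j<dim_row A. A $$ (i, j) * x j) \<le> \<rho> * x i)"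

lemma real_spectral_radius_nonneg:
  assumes "A \<in> carrier_mat n n" "n > 0"
  shows "0 \<le> real_spectral_radius A"
proof -
  have "map_mat complex_of_real A \<in> carrier_mat n n" using assms by simp
  from spectral_radius_mem_max(1)[OF this assms(2)] show ?thesis
    by (auto simp: real_spectral_radius_def)
qed

text \<open>An eigenvector of \<open>c \<cdot>\<^sub>m A\<close> for \<mu> is an eigenvector of
  \<open>A\<close> for \<mu> / c. Equality follows later by applying this once more with
  \<open>1 / c\<close>.\<close>

lemma real_spectral_radius_smult_le:
  assumes A: "A \<in> carrier_mat n n" and n: "n > 0" and c: "c > 0"
  shows "real_spectral_radius (c \<cdot>\<^sub>m A) \<le> c * real_spectral_radius A"
proof -
  let ?A = "map_mat complex_of_real A" and ?B = "map_mat complex_of_real (c \<cdot>\<^sub>m A)"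
  have AB: "?A \<in> carrier_mat n n" "?B \<in> carrier_mat n n" using A by auto
  from spectral_radius_mem_max(1)[OF AB(2) n] obtain \<mu>
    where \<mu>: "\<mu> \<in> spectrum ?B" "real_spectral_radius (c \<cdot>\<^sub>m A) = norm \<mu>"
    by (auto simp: real_spectral_radius_def)
  then obtain v where v: "v \<in> carrier_vec n" "v \<noteq> 0\<^sub>v n" "?B *\<^sub>v v = \<mu> \<cdot>\<^sub>v v"
    using AB by (auto simp: spectrum_def eigenvalue_def eigenvector_def)
  have "?A *\<^sub>v v = (\<mu> / of_real c) \<cdot>\<^sub>v v"
  proof (rule eq_vecI)
    fix i assume "i < dim_vec ((\<mu> / of_real c) \<cdot>\<^sub>v v)"
    then have i: "i < n" using v(1) by simp
    have "of_real c * (?A *\<^sub>v v) $ i = (?B *\<^sub>v v) $ i"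
      using A v(1) i by (simp add: scalar_prod_def sum_distrib_left mult_ac)
    then show "(?A *\<^sub>v v) $ i = ((\<mu> / of_real c) \<cdot>\<^sub>v v) $ i"
      using v i c by (simp add: field_simps)
  qed (use A v(1) in auto)
  then have "\<mu> / of_real c \<in> spectrum ?A"
    using v AB by (auto simp: spectrum_def eigenvalue_def eigenvector_def)
  then have "norm (\<mu> / of_real c) \<le> real_spectral_radius A"
    using spectral_radius_mem_max(2)[OF AB(1) n] by (auto simp: real_spectral_radius_def)
  then show ?thesis using c \<mu>(2) by (simp add: norm_divide field_simps)
qed

text \<open>Let \<open>v\<close> be an eigenvector whose eigenvalue \<mu> has maximal modulus, and
  let \<open>i\<close> be an index where the ratio \<open>norm (v $ i) / x i\<close> attains its
  maximum \<open>M\<close>. Taking norms in row \<open>i\<close> of the eigenvector equation and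
  replacing each \<open>norm (v $ j)\<close> by \<open>M * x j\<close> gives
  \<open>norm \<mu> * (M * x i) \<le> \<rho> * (M * x i)\<close>, and \<open>M\<close> is positive
  because \<open>v\<close> is nonzero.\<close>

lemma real_spectral_radius_le:
  assumes A: "A \<in> carrier_mat n n" and n: "n > 0" and nn: "nonneg_matrix A"
    and x: "positive_supersolution A \<rho> x"
  shows "real_spectral_radius A \<le> \<rho>"
proof -
  let ?A = "map_mat complex_of_real A"
  have AA: "?A \<in> carrier_mat n n" using A by auto
  have nonneg: "0 \<le> A $$ (i, j)" if "i < n" "j < n" for i j
    using nn A that by (auto simp: nonneg_matrix_def)
  have xpos: "0 < x i" and xle: "(\<Sum>j<n. A $$ (i, j) * x j) \<le> \<rho> * x i" if "i < n" for i
    using x A that by (auto simp: positive_supersolution_def)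
  from spectral_radius_mem_max(1)[OF AA n] obtain \<mu>
    where \<mu>: "\<mu> \<in> spectrum ?A" "real_spectral_radius A = norm \<mu>"
    by (auto simp: real_spectral_radius_def)
  then obtain v where v: "v \<in> carrier_vec n" "v \<noteq> 0\<^sub>v n" "?A *\<^sub>v v = \<mu> \<cdot>\<^sub>v v"
    using AA by (auto simp: spectrum_def eigenvalue_def eigenvector_def)
  define m where "m i = norm (v $ i) / x i" for i
  define M where "M = Max (m ` {..<n})"
  have "M \<in> m ` {..<n}" unfolding M_def using n by (intro Max_in) auto
  then obtain i where i: "i < n" "m i = M" by auto
  have le: "norm (v $ j) \<le> M * x j" if "j < n" for j
  proof -
    have "m j \<le> M" unfolding M_def using that by auto
    then show ?thesis using xpos[OF that] by (simp add: m_def field_simps)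
  qed
  obtain k where k: "k < n" "v $ k \<noteq> 0"
    using v(1,2) by (metis carrier_vecD eq_vecI index_zero_vec(1,2))
  have "0 < M"
    using le[OF k(1)] k(2) xpos[OF k(1)] by (smt (verit) mult_nonneg_nonneg mult_nonpos_nonneg zero_less_norm_iff)
  have vi: "norm (v $ i) = M * x i" using i xpos[OF i(1)] by (auto simp: m_def field_simps)
  have "\<mu> * v $ i = (?A *\<^sub>v v) $ i" using v i by simp
  also have "\<dots> = (\<Sum>j<n. of_real (A $$ (i, j)) * v $ j)"
    using A v(1) i(1) by (auto simp: scalar_prod_def atLeast0LessThan intro!: sum.cong)
  finally have "norm \<mu> * norm (v $ i) = norm (\<Sum>j<n. of_real (A $$ (i, j)) * v $ j)"
    by (metis norm_mult)
  also have "\<dots> \<le> (\<Sum>j<n. A $$ (i, j) * norm (v $ j))"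
    using nonneg i by (intro sum_norm_le) (auto simp: norm_mult)
  also have "\<dots> \<le> (\<Sum>j<n. A $$ (i, j) * (M * x j))"
    using nonneg i le by (intro sum_mono mult_left_mono) auto
  also have "\<dots> = M * (\<Sum>j<n. A $$ (i, j) * x j)"
    by (simp add: sum_distrib_left mult_ac)
  also have "\<dots> \<le> M * (\<rho> * x i)" using xle i \<open>0 < M\<close> by auto
  finally have "norm \<mu> * (M * x i) \<le> \<rho> * (M * x i)" using vi by (simp add: mult_ac)
  then show ?thesis using xpos[OF i(1)] \<open>0 < M\<close> \<mu>(2) by simp
qed

text \<open>After division by \<rho> the spectral radius is below 1, so the Jordan normal form
  bounds all powers by one constant; undoing the division produces the factor
  \<open>\<rho> ^ k\<close>.\<close>

lemma mat_pow_entries_bound: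
  assumes A: "A \<in> carrier_mat n n" and n: "n > 0" and r: "real_spectral_radius A < \<rho>"
  obtains c where "\<And>k i j. i < n \<Longrightarrow> j < n \<Longrightarrow> \<bar>(A ^\<^sub>m k) $$ (i, j)\<bar> \<le> c * \<rho> ^ k"
proof -
  have \<rho>: "\<rho> > 0" using real_spectral_radius_nonneg[OF A n] r by linarith
  define B where "B = (1 / \<rho>) \<cdot>\<^sub>m A"
  have B: "B \<in> carrier_mat n n" using A by (simp add: B_def)
  have "real_spectral_radius B \<le> (1 / \<rho>) * real_spectral_radius A"
    unfolding B_def by (intro real_spectral_radius_smult_le[OF A n]) (use \<rho> in simp)
  also have "\<dots> < 1" using r \<rho> by simp
  finally have "\<exists>c. \<forall>k. norm_bound (map_mat complex_of_real B ^\<^sub>m k) c"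
    using B unfolding real_spectral_radius_def
    by (intro spectral_radius_jnf_norm_bound_less_1_upper_triangular[where n = n]) auto
  then obtain c where c: "\<And>k. norm_bound (map_mat complex_of_real (B ^\<^sub>m k)) c"
    by (metis B of_real_hom.mat_hom_pow)
  have pow: "B ^\<^sub>m k = (1 / \<rho>) ^ k \<cdot>\<^sub>m (A ^\<^sub>m k)" for k
  proof (induction k)
    case 0 show ?case using A B by auto
  next
    case (Suc k)
    have "B ^\<^sub>m Suc k = ((1 / \<rho>) ^ k \<cdot>\<^sub>m (A ^\<^sub>m k)) * B" by (simp add: Suc)
    also have "\<dots> = (1 / \<rho>) ^ k \<cdot>\<^sub>m (A ^\<^sub>m k * B)"
      using A B by (intro mult_smult_assoc_mat[where nr = n and n = n and nc = n]) auto
    also have "A ^\<^sub>m k * B = (1 / \<rho>) \<cdot>\<^sub>m (A ^\<^sub>m Suc k)"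
      unfolding B_def using A by (subst mult_smult_distrib[where nr = n and n = n and nc = n]) auto
    finally show ?case using A by (auto simp: mult_ac)
  qed
  have "\<bar>(A ^\<^sub>m k) $$ (i, j)\<bar> \<le> c * \<rho> ^ k" if ij: "i < n" "j < n" for k i j
  proof -
    have *: "B ^\<^sub>m k \<in> carrier_mat n n" "A ^\<^sub>m k \<in> carrier_mat n n" using A B by auto
    have "norm (complex_of_real ((B ^\<^sub>m k) $$ (i, j))) \<le> c"
      using c[of k] ij B by (auto simp: norm_bound_def split: if_splits)
    then have "\<bar>(1 / \<rho>) ^ k * (A ^\<^sub>m k) $$ (i, j)\<bar> \<le> c"
      unfolding norm_of_real pow using ij carrier_matD[OF *(2)] by (simp del: pow_mat_dim)
    then show ?thesis using \<rho> by (simp add: abs_mult power_one_over field_simps)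
  qed
  then show thesis by (rule that)
qed

text \<open>The witness is a truncated Neumann series: \<open>x\<close> is the sum over
  \<open>k < N\<close> of \<open>A ^\<^sub>m k\<close> applied to the all-ones vector, divided by
  \<open>\<rho> ^ k\<close>. Applying \<open>A\<close> shifts the series, so row \<open>i\<close> of
  the product is \<rho> times \<open>x i + w N i / \<rho> ^ N - 1\<close>, and \<open>N\<close> is
  chosen so that the new term is at most 1.\<close>

lemma ex_positive_supersolution:
  assumes A: "A \<in> carrier_mat n n" and n: "n > 0" and nn: "nonneg_matrix A"
    and r: "real_spectral_radius A < \<rho>"
  obtains x where "positive_supersolution A \<rho> x"
proof -
  \<comment> \<open>The powers of \<open>A\<close> grow at most like those of \<sigma>, so the gap
    between \<sigma> and \<rho> makes \<open>w k i / \<rho> ^ k\<close> tend to 0.\<close>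
  obtain \<sigma> where \<sigma>: "real_spectral_radius A < \<sigma>" "\<sigma> < \<rho>" using r dense by blast
  have pos: "\<sigma> > 0" "\<rho> > 0" using real_spectral_radius_nonneg[OF A n] \<sigma> by linarith+
  obtain c where c: "\<And>k i j. i < n \<Longrightarrow> j < n \<Longrightarrow> \<bar>(A ^\<^sub>m k) $$ (i, j)\<bar> \<le> c * \<sigma> ^ k"
    using mat_pow_entries_bound[OF A n \<sigma>(1)] by metis
  have nonneg: "0 \<le> A $$ (i, j)" if "i < n" "j < n" for i j
    using nn A that by (auto simp: nonneg_matrix_def)
  define w where "w k i = (\<Sum>j<n. (A ^\<^sub>m k) $$ (i, j))" for k i
  have w0: "w 0 i = 1" if "i < n" for i using that A by (simp add: w_def)
  have wSuc: "w (Suc k) i = (\<Sum>j<n. A $$ (i, j) * w k j)" if "i < n" for k i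
  proof -
    \<comment> \<open>Powers are defined by multiplication on the right, whereas the recursion for
      row sums splits off the left factor.\<close>
    have "A ^\<^sub>m Suc k = A * A ^\<^sub>m k"
    proof (induction k)
      case (Suc k)
      have "A ^\<^sub>m Suc (Suc k) = A * A ^\<^sub>m k * A" using Suc by simp
      also have "\<dots> = A * (A ^\<^sub>m k * A)"
        using A by (intro assoc_mult_mat[where n\<^sub>1 = n and n\<^sub>2 = n and n\<^sub>3 = n and n\<^sub>4 = n]) auto
      finally show ?case by simp
    qed (use A in auto)
    then have "w (Suc k) i = (\<Sum>j<n. \<Sum>l<n. A $$ (i, l) * (A ^\<^sub>m k) $$ (l, j))"
      using A that by (simp add: w_def scalar_prod_def atLeast0LessThan)
    also have "\<dots> = (\<Sum>l<n. \<Sum>j<n. A $$ (i, l) * (A ^\<^sub>m k) $$ (l, j))"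
      by (rule sum.swap)
    finally show ?thesis by (simp add: w_def sum_distrib_left)
  qed
  have wnn: "0 \<le> w k i" if "i < n" for k i
    using that
  proof (induction k arbitrary: i)
    case (Suc k) then show ?case using nonneg by (auto simp: wSuc intro!: sum_nonneg)
  qed (simp add: w0)
  have wle: "w k i \<le> n * c * \<sigma> ^ k" if "i < n" for k i
  proof -
    have "w k i \<le> (\<Sum>j<n. c * \<sigma> ^ k)"
      unfolding w_def using c[OF that] by (intro sum_mono) (smt (verit) lessThan_iff)
    then show ?thesis by (simp add: mult_ac)
  qed
  have "(\<lambda>k. n * c * (\<sigma> / \<rho>) ^ k) \<longlonglongrightarrow> n * c * 0"
    using pos \<sigma> by (intro tendsto_intros LIMSEQ_power_zero) auto
  then have "eventually (\<lambda>k. n * c * (\<sigma> / \<rho>) ^ k < 1) sequentially"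
    by (rule order_tendstoD) simp
  then obtain N where "n * c * (\<sigma> / \<rho>) ^ N < 1"
    by (auto simp: eventually_sequentially)
  then have "n * c * \<sigma> ^ N < \<rho> ^ N" using pos by (simp add: power_divide field_simps)
  then have wN: "w N i / \<rho> ^ N \<le> 1" if "i < n" for i
    using wle[OF that, of N] pos by simp
  \<comment> \<open>For \<open>N = 0\<close> the series would be empty and \<open>x\<close> would
    vanish. This is excluded because the bound at \<open>k = 0\<close> already forces
    \<open>n * c\<close> to be at least 1.\<close>
  have N: "N > 0"
  proof (rule ccontr)
    assume "\<not> N > 0"
    then have "real n * c < 1" using \<open>n * c * \<sigma> ^ N < \<rho> ^ N\<close> by simp
    then show False using wle[of 0 0] w0[of 0] n by simp
  qed
  define x where "x i = (\<Sum>k<N. w k i / \<rho> ^ k)" for i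
  have "positive_supersolution A \<rho> x"
    unfolding positive_supersolution_def
  proof (intro allI impI conjI)
    fix i assume "i < dim_row A"
    then have i: "i < n" using A by simp
    have "w 0 i / \<rho> ^ 0 \<le> x i"
      unfolding x_def using N wnn[OF i] pos by (intro member_le_sum) auto
    then show "0 < x i" using w0[OF i] by simp
    have "(\<Sum>j<n. A $$ (i, j) * x j) = (\<Sum>k<N. \<Sum>j<n. A $$ (i, j) * w k j / \<rho> ^ k)"
      unfolding x_def by (subst sum.swap) (simp add: sum_distrib_left)
    also have "\<dots> = (\<Sum>k<N. w (Suc k) i / \<rho> ^ k)"
      by (simp add: wSuc[OF i] sum_divide_distrib)
    also have "\<dots> = \<rho> * (\<Sum>k<N. w (Suc k) i / \<rho> ^ Suc k)"
      using pos by (simp add: sum_distrib_left)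
    also have "(\<Sum>k<N. w (Suc k) i / \<rho> ^ Suc k) = x i + w N i / \<rho> ^ N - w 0 i / \<rho> ^ 0"
      unfolding x_def using sum.lessThan_Suc_shift[of "\<lambda>k. w k i / \<rho> ^ k" N]
      by (simp add: sum.lessThan_Suc)
    also have "\<rho> * \<dots> \<le> \<rho> * x i"
      using wN[OF i] w0[OF i] pos by (intro mult_left_mono) auto
    finally show "(\<Sum>j<dim_row A. A $$ (i, j) * x j) \<le> \<rho> * x i" using A by simp
  qed
  then show thesis by (rule that)
qed

text \<open>A positive supersolution of the larger matrix is one of the smaller matrix. The infimum
  need not be attained, so the argument runs over all \<sigma> below the radius of \<open>A\<close>:
  if \<sigma> exceeded the radius of \<open>B\<close>, a supersolution of \<open>B\<close> at
  \<sigma> would bound the radius of \<open>A\<close> by \<sigma>.\<close>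

lemma real_spectral_radius_mono:
  assumes A: "A \<in> carrier_mat n n" and B: "B \<in> carrier_mat n n" and n: "n > 0"
    and nn: "nonneg_matrix A"
    and le: "\<And>i j. i < n \<Longrightarrow> j < n \<Longrightarrow> A $$ (i, j) \<le> B $$ (i, j)"
  shows "real_spectral_radius A \<le> real_spectral_radius B"
proof (rule dense_le)
  fix \<sigma> assume "real_spectral_radius A > \<sigma>"
  show "\<sigma> \<le> real_spectral_radius B"
  proof (rule ccontr)
    assume "\<not> \<sigma> \<le> real_spectral_radius B"
    moreover have "nonneg_matrix B"
      unfolding nonneg_matrix_def using nn A B le
      by (metis carrier_matD nonneg_matrix_def order_trans)
    ultimately obtain x where x: "positive_supersolution B \<sigma> x"
      using ex_positive_supersolution[OF B n] by (metis not_le)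
    have "positive_supersolution A \<sigma> x"
      unfolding positive_supersolution_def
    proof (intro allI impI conjI)
      fix i assume "i < dim_row A"
      then have i: "i < n" using A by simp
      show "0 < x i" using x B i by (auto simp: positive_supersolution_def)
      have "(\<Sum>j<n. A $$ (i, j) * x j) \<le> (\<Sum>j<n. B $$ (i, j) * x j)"
        using x B i le by (intro sum_mono mult_right_mono) (auto simp: positive_supersolution_def less_imp_le)
      also have "\<dots> \<le> \<sigma> * x i" using x B i by (auto simp: positive_supersolution_def)
      finally show "(\<Sum>j<dim_row A. A $$ (i, j) * x j) \<le> \<sigma> * x i" using A by simp
    qed
    then have "real_spectral_radius A \<le> \<sigma>" by (rule real_spectral_radius_le[OF A n nn])
    then show False using \<open>real_spectral_radius A > \<sigma>\<close> by simp
  qed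
qed

lemma real_spectral_radius_smult:
  assumes A: "A \<in> carrier_mat n n" and n: "n > 0" and c: "c > 0"
  shows "real_spectral_radius (c \<cdot>\<^sub>m A) = c * real_spectral_radius A"
proof (rule antisym)
  show "real_spectral_radius (c \<cdot>\<^sub>m A) \<le> c * real_spectral_radius A"
    by (rule real_spectral_radius_smult_le[OF assms])
  have "(1 / c) \<cdot>\<^sub>m (c \<cdot>\<^sub>m A) = A" using A c by auto
  then have "real_spectral_radius A \<le> (1 / c) * real_spectral_radius (c \<cdot>\<^sub>m A)"
    using real_spectral_radius_smult_le[of "c \<cdot>\<^sub>m A" n "1 / c"] A n c by simp
  then show "c * real_spectral_radius A \<le> real_spectral_radius (c \<cdot>\<^sub>m A)"
    using c by (simp add: field_simps)
qed

section \<open>Row scalings\<close>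

text \<open>This is \<open>mat_exp C * A\<close> for a diagonal matrix \<open>C\<close> with
  diagonal \<open>c\<close>. Working with the function \<open>c\<close> keeps the matrix exponential
  out of the analysis.\<close>

definition scale_rows :: "(nat \<Rightarrow> real) \<Rightarrow> real mat \<Rightarrow> real mat" where
  "scale_rows c A = mat (dim_row A) (dim_col A) (\<lambda>(i, j). exp (c i) * A $$ (i, j))"

lemma scale_rows_carrier [simp]: "scale_rows c A \<in> carrier_mat n m \<longleftrightarrow> A \<in> carrier_mat n m"
  unfolding scale_rows_def carrier_mat_def by simp

lemma scale_rows_dim [simp]:
  "dim_row (scale_rows c A) = dim_row A" "dim_col (scale_rows c A) = dim_col A"
  by (auto simp: scale_rows_def)

lemma scale_rows_index [simp]:
  "i < dim_row A \<Longrightarrow> j < dim_col A \<Longrightarrow> scale_rows c A $$ (i, j) = exp (c i) * A $$ (i, j)"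
  by (simp add: scale_rows_def)

lemma nonneg_scale_rows [simp]: "nonneg_matrix A \<Longrightarrow> nonneg_matrix (scale_rows c A)"
  by (auto simp: nonneg_matrix_def)

lemma scale_rows_const_add:
  "(\<And>i. i < dim_row A \<Longrightarrow> c i = k + d i) \<Longrightarrow> scale_rows c A = exp k \<cdot>\<^sub>m scale_rows d A"
  by (auto simp: scale_rows_def exp_add)

lemma scale_rows_zero: "(\<And>i. i < dim_row A \<Longrightarrow> c i = 0) \<Longrightarrow> scale_rows c A = A"
  by (auto simp: scale_rows_def)

lemma positive_supersolution_scale_rows:
  assumes "A \<in> carrier_mat n n"
  shows "positive_supersolution (scale_rows c A) \<rho> x \<longleftrightarrow>
    (\<forall>i<n. 0 < x i \<and> exp (c i) * (\<Sum>j<n. A $$ (i, j) * x j) \<le> \<rho> * x i)"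
  using assms by (auto simp: positive_supersolution_def sum_distrib_left mult_ac)

text \<open>The scaled matrix dominates \<open>exp m \<cdot>\<^sub>m A\<close> entrywise, where
  \<open>m\<close> is the least exponent. Positivity ensures that the logarithms are genuine and not
  default values of \<open>ln\<close>.\<close>

lemma real_spectral_radius_scale_rows_pos:
  assumes A: "A \<in> carrier_mat n n" and n: "n > 0" and nn: "nonneg_matrix A"
    and r: "0 < real_spectral_radius A"
  shows "0 < real_spectral_radius (scale_rows c A)"
proof -
  define m where "m = Min (c ` {..<n})"
  have m: "m \<le> c i" if "i < n" for i unfolding m_def using that by auto
  have "0 < exp m * real_spectral_radius A" using r by simp
  also have "\<dots> = real_spectral_radius (exp m \<cdot>\<^sub>m A)"
    using real_spectral_radius_smult[OF A n] by simp
  also have "\<dots> \<le> real_spectral_radius (scale_rows c A)"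
    using A n nn m by (intro real_spectral_radius_mono[where n = n])
      (auto simp: nonneg_matrix_def intro!: mult_right_mono)
  finally show ?thesis .
qed

section \<open>AM-GM, Hoelder and log-convexity\<close>

text \<open>Divide by the geometric mean \<open>g\<close>: the weighted logarithms of
  \<open>u / g\<close> and \<open>v / g\<close> then sum to 0, and \<open>ln z \<le> z - 1\<close>
  applied to both gives the inequality. Equality makes both applications tight, which happens only
  at \<open>z = 1\<close>.\<close>

lemma weighted_AM_GM:
  fixes u v t :: real
  assumes u: "u > 0" and v: "v > 0" and t: "0 < t" "t < 1"
  shows "u powr (1 - t) * v powr t \<le> (1 - t) * u + t * v"
    and "u powr (1 - t) * v powr t = (1 - t) * u + t * v \<Longrightarrow> u = v"
proof -
  define g where "g = u powr (1 - t) * v powr t"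
  have g: "g > 0" using u v by (simp add: g_def)
  have "ln g = (1 - t) * ln u + t * ln v"
    using u v by (simp add: g_def ln_mult ln_powr)
  then have sum0: "(1 - t) * ln (u / g) + t * ln (v / g) = 0"
    using u v g by (simp add: ln_div algebra_simps)
  have U: "ln (u / g) \<le> u / g - 1" and V: "ln (v / g) \<le> v / g - 1"
    using u v g by (auto intro!: ln_le_minus_one)
  have tU: "(1 - t) * ln (u / g) \<le> (1 - t) * (u / g - 1)"
    and tV: "t * ln (v / g) \<le> t * (v / g - 1)"
    using U V t by (auto intro!: mult_left_mono)
  have id: "(1 - t) * (u / g - 1) + t * (v / g - 1) = ((1 - t) * u + t * v) / g - 1"
    using g by (simp add: field_simps)
  have "1 \<le> ((1 - t) * u + t * v) / g" using tU tV sum0 id by linarith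
  then show "u powr (1 - t) * v powr t \<le> (1 - t) * u + t * v"
    unfolding g_def[symmetric] using g by (simp add: field_simps)
  assume "u powr (1 - t) * v powr t = (1 - t) * u + t * v"
  then have "((1 - t) * u + t * v) / g = 1" using g by (simp add: g_def)
  then have "(1 - t) * ln (u / g) = (1 - t) * (u / g - 1)" "t * ln (v / g) = t * (v / g - 1)"
    using tU tV sum0 id by linarith+
  then have "ln (u / g) = u / g - 1" "ln (v / g) = v / g - 1" using t by auto
  then have "u / g = 1" "v / g = 1"
    using ln_eq_minus_one[OF divide_pos_pos[OF u g]] ln_eq_minus_one[OF divide_pos_pos[OF v g]]
    by blast+
  then show "u = v" using g by simp
qed

text \<open>Normalise both sums on the right to 1 and add up the weighted AM-GM inequalities of the
  individual terms. If the sums agree, every term agrees, so wherever the weight is positive the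
  normalised values of \<open>x\<close> and \<open>y\<close> coincide.\<close>

lemma weighted_Holder:
  fixes a x y :: "'a \<Rightarrow> real"
  assumes fin: "finite I" and a: "\<And>j. j \<in> I \<Longrightarrow> 0 \<le> a j"
    and x: "\<And>j. j \<in> I \<Longrightarrow> 0 < x j" and y: "\<And>j. j \<in> I \<Longrightarrow> 0 < y j"
    and t: "0 < t" "t < 1"
  shows "(\<Sum>j\<in>I. a j * (x j powr (1 - t) * y j powr t))
           \<le> (\<Sum>j\<in>I. a j * x j) powr (1 - t) * (\<Sum>j\<in>I. a j * y j) powr t" (is "?L \<le> ?R")
    and "\<lbrakk>(\<Sum>j\<in>I. a j * (x j powr (1 - t) * y j powr t))
           = (\<Sum>j\<in>I. a j * x j) powr (1 - t) * (\<Sum>j\<in>I. a j * y j) powr t; k \<in> I; 0 < a k\<rbrakk>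
         \<Longrightarrow> x k / (\<Sum>j\<in>I. a j * x j) = y k / (\<Sum>j\<in>I. a j * y j)"
proof -
  define X where "X = (\<Sum>j\<in>I. a j * x j)"
  define Y where "Y = (\<Sum>j\<in>I. a j * y j)"
  define f where "f j = a j * ((x j / X) powr (1 - t) * (y j / Y) powr t)" for j
  define g where "g j = a j * ((1 - t) * (x j / X) + t * (y j / Y))" for j
  \<comment> \<open>Both sums vanish when all weights do, so positivity is tied to one positive
    weight and the degenerate case is treated apart.\<close>
  have XY: "0 < X" "0 < Y" if "k \<in> I" "0 < a k" for k
    unfolding X_def Y_def using that fin a x y
    by (intro sum_pos2[OF fin that(1)]; simp add: less_imp_le)+
  have fg: "f j \<le> g j" if "j \<in> I" "0 < X" "0 < Y" for j
    unfolding f_def g_def using that a x y t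
    by (intro mult_left_mono weighted_AM_GM) auto
  have sumg: "sum g I = 1" if "0 < X" "0 < Y"
  proof -
    have "sum g I = (\<Sum>j\<in>I. (1 - t) / X * (a j * x j) + t / Y * (a j * y j))"
      unfolding g_def by (intro sum.cong) (auto simp: algebra_simps)
    also have "\<dots> = (1 - t) / X * X + t / Y * Y"
      unfolding sum.distrib X_def Y_def sum_distrib_left ..
    finally have "sum g I = (1 - t) * (X / X) + t * (Y / Y)" by simp
    then show ?thesis using that by simp
  qed
  have sumf: "?L = X powr (1 - t) * Y powr t * sum f I" if "0 < X" "0 < Y"
    unfolding f_def sum_distrib_left
  proof (rule sum.cong[OF refl])
    fix j assume "j \<in> I"
    then have "0 < x j" "0 < y j" using x y by auto
    then show "a j * (x j powr (1 - t) * y j powr t)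
        = X powr (1 - t) * Y powr t * (a j * ((x j / X) powr (1 - t) * (y j / Y) powr t))"
      using that by (simp add: powr_divide)
  qed
  show "?L \<le> ?R"
  proof (cases "\<exists>k\<in>I. 0 < a k")
    case True
    then have *: "0 < X" "0 < Y" using XY by auto
    have "sum f I \<le> sum g I" using fg * by (intro sum_mono) auto
    then have "sum f I \<le> 1" using sumg * by simp
    then have "?L \<le> X powr (1 - t) * Y powr t * 1"
      unfolding sumf[OF *] by (intro mult_left_mono) auto
    then show ?thesis by (simp add: X_def Y_def)
  next
    case False
    then have "a j = 0" if "j \<in> I" for j using a[OF that] that by force
    then show ?thesis by simp
  qed
  assume eq: "?L = ?R" and k: "k \<in> I" "0 < a k"
  note * = XY[OF k]
  have "sum f I = sum g I"
    using eq sumf[OF *] sumg[OF *] * by (simp add: X_def[symmetric] Y_def[symmetric])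
  then have "f k = g k"
    by (rule sum_mono_inv[OF _ _ k(1) fin]) (use fg * in auto)
  then have "(x k / X) powr (1 - t) * (y k / Y) powr t = (1 - t) * (x k / X) + t * (y k / Y)"
    using k by (simp add: f_def g_def)
  then have "x k / X = y k / Y"
    by (rule weighted_AM_GM(2)[OF _ _ t, rotated 2]) (use x[OF k(1)] y[OF k(1)] * in auto)
  then show "x k / (\<Sum>j\<in>I. a j * x j) = y k / (\<Sum>j\<in>I. a j * y j)"
    by (simp add: X_def Y_def)
qed

text \<open>The bounds \<rho> and \<sigma> are left free because the lemma serves twice: slightly
  above the spectral radii for convexity, and exactly at them for the case of equality.\<close>

lemma positive_supersolution_interpolate:
  assumes A: "A \<in> carrier_mat n n" and nn: "nonneg_matrix A"
    and \<rho>: "0 \<le> \<rho>" "0 \<le> \<sigma>"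
    and x: "positive_supersolution (scale_rows c A) \<rho> x"
    and y: "positive_supersolution (scale_rows d A) \<sigma> y"
    and t: "0 < t" "t < 1"
  shows "positive_supersolution (scale_rows (\<lambda>i. (1 - t) * c i + t * d i) A)
           (\<rho> powr (1 - t) * \<sigma> powr t) (\<lambda>i. x i powr (1 - t) * y i powr t)"
  unfolding positive_supersolution_scale_rows[OF A]
proof (intro allI impI conjI)
  fix i assume i: "i < n"
  have xy: "0 < x j" "0 < y j" if "j < n" for j
    using x y that unfolding positive_supersolution_scale_rows[OF A] by auto
  show "0 < x i powr (1 - t) * y i powr t" using xy[OF i] by simp
  let ?X = "\<Sum>j<n. A $$ (i, j) * x j" and ?Y = "\<Sum>j<n. A $$ (i, j) * y j"
  have nonneg: "0 \<le> A $$ (i, j)" if "j < n" for j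
    using nn A that i by (auto simp: nonneg_matrix_def)
  have X: "0 \<le> ?X" "0 \<le> ?Y" using nonneg xy by (auto intro!: sum_nonneg simp: less_imp_le)
  have "exp ((1 - t) * c i + t * d i) * (\<Sum>j<n. A $$ (i, j) * (x j powr (1 - t) * y j powr t))
      \<le> exp ((1 - t) * c i + t * d i) * (?X powr (1 - t) * ?Y powr t)"
    using nonneg xy t by (intro mult_left_mono weighted_Holder) auto
  also have "\<dots> = (exp (c i) * ?X) powr (1 - t) * (exp (d i) * ?Y) powr t"
    using X by (simp add: powr_mult exp_add exp_powr_real mult_ac)
  also have "\<dots> \<le> (\<rho> * x i) powr (1 - t) * (\<sigma> * y i) powr t"
  proof (rule mult_mono[OF powr_mono2 powr_mono2])
    show "exp (c i) * ?X \<le> \<rho> * x i" "exp (d i) * ?Y \<le> \<sigma> * y i"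
      using x y i unfolding positive_supersolution_scale_rows[OF A] by auto
  qed (use X t in auto)
  also have "\<dots> = \<rho> powr (1 - t) * \<sigma> powr t * (x i powr (1 - t) * y i powr t)"
    using xy[OF i] \<rho> by (simp add: powr_mult)
  finally show "exp ((1 - t) * c i + t * d i)
      * (\<Sum>j<n. A $$ (i, j) * (x j powr (1 - t) * y j powr t))
      \<le> \<rho> powr (1 - t) * \<sigma> powr t * (x i powr (1 - t) * y i powr t)" .
qed

text \<open>Supersolutions exist strictly above the radii, so both radii are enlarged by the factor
  \<open>exp \<epsilon>\<close>. The weights \<open>1 - t\<close> and \<open>t\<close> add up to 1,
  so the logarithm of the interpolated bound grows by exactly \<epsilon>, which is
  arbitrary.\<close>

lemma real_spectral_radius_log_convex:
  assumes A: "A \<in> carrier_mat n n" and n: "n > 0" and nn: "nonneg_matrix A"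
    and r: "0 < real_spectral_radius A" and t: "0 < t" "t < 1"
  shows "ln (real_spectral_radius (scale_rows (\<lambda>i. (1 - t) * c i + t * d i) A))
    \<le> (1 - t) * ln (real_spectral_radius (scale_rows c A))
       + t * ln (real_spectral_radius (scale_rows d A))"
proof -
  define R where "R c = real_spectral_radius (scale_rows c A)" for c
  have R: "0 < R c" for c
    unfolding R_def by (rule real_spectral_radius_scale_rows_pos[OF A n nn r])
  let ?e = "\<lambda>i. (1 - t) * c i + t * d i"
  have *: "R ?e \<le> (exp \<epsilon> * R c) powr (1 - t) * (exp \<epsilon> * R d) powr t" if "\<epsilon> > 0" for \<epsilon>
  proof -
    have 1: "R c < exp \<epsilon> * R c" for c using R[of c] that by simp
    obtain x where x: "positive_supersolution (scale_rows c A) (exp \<epsilon> * R c) x"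
      using ex_positive_supersolution[OF _ n] A nn 1[of c] unfolding R_def
      by (metis nonneg_scale_rows scale_rows_carrier)
    obtain y where y: "positive_supersolution (scale_rows d A) (exp \<epsilon> * R d) y"
      using ex_positive_supersolution[OF _ n] A nn 1[of d] unfolding R_def
      by (metis nonneg_scale_rows scale_rows_carrier)
    have "positive_supersolution (scale_rows ?e A)
        ((exp \<epsilon> * R c) powr (1 - t) * (exp \<epsilon> * R d) powr t) (\<lambda>i. x i powr (1 - t) * y i powr t)"
      using R by (intro positive_supersolution_interpolate[OF A nn _ _ x y t]) (auto simp: less_imp_le)
    then show ?thesis
      unfolding R_def using A n nn by (intro real_spectral_radius_le[where n = n]) auto
  qed
  have "ln (R ?e) \<le> (1 - t) * ln (R c) + t * ln (R d) + \<epsilon>" if "\<epsilon> > 0" for \<epsilon>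
  proof -
    have "ln (R ?e) \<le> ln ((exp \<epsilon> * R c) powr (1 - t) * (exp \<epsilon> * R d) powr t)"
      using *[OF that] R[of ?e] by (intro ln_mono) auto
    also have "\<dots> = (1 - t) * ln (R c) + t * ln (R d) + \<epsilon>"
      using R[of c] R[of d] by (simp add: ln_mult ln_powr algebra_simps)
    finally show ?thesis .
  qed
  then have "ln (R ?e) \<le> (1 - t) * ln (R c) + t * ln (R d)" by (rule field_le_epsilon)
  then show ?thesis by (simp add: R_def)
qed

section \<open>Irreducible matrices: the infimum is attained by an eigenvector\<close>

text \<open>The form in which irreducibility is applied: in the digraph of nonzero entries, an edge
  leaves every nonempty proper set of indices.\<close>

lemma irreducible_matrixD:
  assumes "irreducible_matrix A" "S \<subseteq> {..<dim_row A}" "S \<noteq> {}" "S \<noteq> {..<dim_row A}"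
  obtains i j where "i \<in> S" "j < dim_row A" "j \<notin> S" "A $$ (i, j) \<noteq> 0"
proof -
  have "\<exists>i\<in>S. \<exists>j\<in>{..<dim_row A} - S. A $$ (i, j) \<noteq> 0"
  proof (rule ccontr)
    assume "\<not> ?thesis"
    then have "S \<noteq> {} \<and> {..<dim_row A} - S \<noteq> {} \<and> S \<inter> ({..<dim_row A} - S) = {} \<and>
        S \<union> ({..<dim_row A} - S) = {..<dim_row A} \<and>
        (\<forall>i\<in>S. \<forall>j\<in>{..<dim_row A} - S. A $$ (i, j) = 0)"
      using assms by blast
    then have "\<not> irreducible_matrix A"
      unfolding irreducible_matrix_def not_not
      by (rule exI[of _ S, OF exI[of _ "{..<dim_row A} - S"]])
    then show False using assms(1) by contradiction
  qed
  then show thesis using that by blast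
qed

lemma reducible_matrixE:
  assumes "\<not> irreducible_matrix A"
  obtains S T where "S \<noteq> {}" "T \<noteq> {}" "S \<inter> T = {}" "S \<union> T = {..<dim_row A}"
    "\<And>i j. i \<in> S \<Longrightarrow> j \<in> T \<Longrightarrow> A $$ (i, j) = 0"
proof -
  have "\<exists>S T. S \<noteq> {} \<and> T \<noteq> {} \<and> S \<inter> T = {} \<and> S \<union> T = {..<dim_row A} \<and>
      (\<forall>i\<in>S. \<forall>j\<in>T. A $$ (i, j) = 0)"
    using assms unfolding irreducible_matrix_def not_not .
  then obtain S T where *: "S \<noteq> {} \<and> T \<noteq> {} \<and> S \<inter> T = {} \<and> S \<union> T = {..<dim_row A} \<and>
      (\<forall>i\<in>S. \<forall>j\<in>T. A $$ (i, j) = 0)"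
    by (elim exE)
  show thesis by (rule that[of S T]) (use * in simp_all)
qed

lemma irreducible_scale_rows:
  assumes "irreducible_matrix A" "A \<in> carrier_mat n n"
  shows "irreducible_matrix (scale_rows c A)"
  unfolding irreducible_matrix_def
proof
  assume "\<exists>S\<^sub>1 S\<^sub>2. S\<^sub>1 \<noteq> {} \<and> S\<^sub>2 \<noteq> {} \<and> S\<^sub>1 \<inter> S\<^sub>2 = {} \<and> S\<^sub>1 \<union> S\<^sub>2 = {..<dim_row (scale_rows c A)} \<and>
    (\<forall>i\<in>S\<^sub>1. \<forall>j\<in>S\<^sub>2. scale_rows c A $$ (i, j) = 0)"
  then obtain S T where S: "S \<noteq> {}" "T \<noteq> {}" "S \<inter> T = {}" "S \<union> T = {..<n}"
    and z: "\<forall>i\<in>S. \<forall>j\<in>T. scale_rows c A $$ (i, j) = 0"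
    using assms(2) by auto
  have "A $$ (i, j) = 0" if "i \<in> S" "j \<in> T" for i j
  proof -
    have "i < n" "j < n" using that S(4) by auto
    moreover have "scale_rows c A $$ (i, j) = 0" using z that by blast
    ultimately show ?thesis using assms(2) by simp
  qed
  then have "S \<noteq> {} \<and> T \<noteq> {} \<and> S \<inter> T = {} \<and> S \<union> T = {..<dim_row A} \<and>
      (\<forall>i\<in>S. \<forall>j\<in>T. A $$ (i, j) = 0)"
    using S assms(2) by simp
  then have "\<not> irreducible_matrix A"
    unfolding irreducible_matrix_def not_not by (rule exI[of _ S, OF exI[of _ T]])
  then show False using assms(1) by contradiction
qed

text \<open>Each new coordinate is handled by passing to a further subsequence on which it is
  monotone, hence convergent, while the earlier coordinates keep their limits.\<close>

lemma finite_dim_Bolzano_Weierstrass: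
  fixes f :: "nat \<Rightarrow> nat \<Rightarrow> real"
  assumes "\<And>k i. i < n \<Longrightarrow> \<bar>f k i\<bar> \<le> B"
  shows "\<exists>r x. strict_mono r \<and> (\<forall>i<n. (\<lambda>k. f (r k) i) \<longlonglongrightarrow> x i)"
  using assms
proof (induction n)
  case 0
  show ?case by (intro exI[of _ id]) (auto simp: strict_mono_def)
next
  case (Suc n)
  then obtain r :: "nat \<Rightarrow> nat" and x
    where r: "strict_mono r" "\<forall>i<n. (\<lambda>k. f (r k) i) \<longlonglongrightarrow> x i"
    by (metis less_SucI)
  obtain s :: "nat \<Rightarrow> nat" where s: "strict_mono s" "monoseq (\<lambda>k. f (r (s k)) n)"
    using seq_monosub[of "\<lambda>k. f (r k) n"] by auto
  have "Bseq (\<lambda>k. f (r (s k)) n)"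
    by (rule BseqI'[where K = B]) (use Suc.prems in auto)
  then obtain l where l: "(\<lambda>k. f (r (s k)) n) \<longlonglongrightarrow> l"
    using Bseq_monoseq_convergent s(2) unfolding convergent_def by blast
  have "(\<lambda>k. f ((r \<circ> s) k) i) \<longlonglongrightarrow> (x(n := l)) i" if "i < Suc n" for i
  proof (cases "i = n")
    case False
    then show ?thesis
      using that LIMSEQ_subseq_LIMSEQ[OF r(2)[rule_format, of i] s(1)] by (simp add: o_def)
  qed (use l in simp)
  then show ?case using strict_mono_o[OF r(1) s(1)] by blast
qed

text \<open>Compactness: supersolutions for bounds decreasing to the radius are normalised to
  coordinate sum 1 and a subsequence converges. The limit satisfies the inequality at the radius
  itself but is at first only nonnegative; irreducibility makes it positive.\<close>

lemma irreducible_ex_supersolution: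
  assumes A: "A \<in> carrier_mat n n" and n: "n > 0" and nn: "nonneg_matrix A"
    and irr: "irreducible_matrix A"
  obtains x where "positive_supersolution A (real_spectral_radius A) x"
proof -
  define r where "r = real_spectral_radius A"
  have nonneg: "0 \<le> A $$ (i, j)" if "i < n" "j < n" for i j
    using nn A that by (auto simp: nonneg_matrix_def)
  define \<rho> where "\<rho> k = r + 1 / real (Suc k)" for k
  have "\<exists>x. positive_supersolution A (\<rho> k) x" for k
    using ex_positive_supersolution[OF A n nn, of "\<rho> k"] by (auto simp: \<rho>_def r_def)
  then obtain y where y: "\<And>k. positive_supersolution A (\<rho> k) (y k)" by metis
  define s where "s k = (\<Sum>i<n. y k i)" for k
  have ypos: "0 < y k i" if "i < n" for k i
    using y[of k] A that by (auto simp: positive_supersolution_def)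
  have s: "0 < s k" for k unfolding s_def using n ypos by (intro sum_pos) auto
  define z where "z k i = y k i / s k" for k i
  have z0: "0 < z k i" if "i < n" for k i using ypos[OF that] s by (simp add: z_def)
  have zsum: "(\<Sum>i<n. z k i) = 1" for k
    using s[of k] by (simp add: z_def s_def flip: sum_divide_distrib)
  have z1: "\<bar>z k i\<bar> \<le> 1" if "i < n" for k i
  proof -
    have "z k i \<le> (\<Sum>i<n. z k i)" using that z0 by (intro member_le_sum) (auto simp: less_imp_le)
    then show ?thesis using zsum z0[OF that, of k] by simp
  qed
  have zle: "(\<Sum>j<n. A $$ (i, j) * z k j) \<le> \<rho> k * z k i" if "i < n" for k i
  proof -
    have "(\<Sum>j<n. A $$ (i, j) * z k j) = (\<Sum>j<n. A $$ (i, j) * y k j) / s k"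
      by (simp add: z_def sum_divide_distrib)
    also have "\<dots> \<le> \<rho> k * y k i / s k"
      using y[of k] A that s[of k] by (intro divide_right_mono) (auto simp: positive_supersolution_def)
    finally show ?thesis by (simp add: z_def)
  qed
  obtain q x where q: "strict_mono q" and x: "\<And>i. i < n \<Longrightarrow> (\<lambda>k. z (q k) i) \<longlonglongrightarrow> x i"
    using finite_dim_Bolzano_Weierstrass[of n z 1] z1 by blast
  have x0: "0 \<le> x i" if "i < n" for i
    using x[OF that] by (rule LIMSEQ_le_const) (use z0[OF that] in \<open>auto simp: less_imp_le\<close>)
  have "(\<lambda>k. \<Sum>i<n. z (q k) i) \<longlonglongrightarrow> (\<Sum>i<n. x i)" using x by (intro tendsto_sum) auto
  then have "(\<lambda>k. 1) \<longlonglongrightarrow> (\<Sum>i<n. x i)" by (simp add: zsum)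
  then have xsum: "(\<Sum>i<n. x i) = 1" by (simp add: LIMSEQ_const_iff)
  have "\<rho> \<longlonglongrightarrow> r + 0"
    unfolding \<rho>_def by (intro tendsto_add tendsto_const LIMSEQ_Suc[OF lim_1_over_n])
  then have \<rho>: "(\<lambda>k. \<rho> (q k)) \<longlonglongrightarrow> r"
    using LIMSEQ_subseq_LIMSEQ[OF _ q] by (auto simp: o_def)
  have xle: "(\<Sum>j<n. A $$ (i, j) * x j) \<le> r * x i" if "i < n" for i
  proof (rule LIMSEQ_le)
    show "(\<lambda>k. \<Sum>j<n. A $$ (i, j) * z (q k) j) \<longlonglongrightarrow> (\<Sum>j<n. A $$ (i, j) * x j)"
      using x by (intro tendsto_intros) auto
    show "(\<lambda>k. \<rho> (q k) * z (q k) i) \<longlonglongrightarrow> r * x i"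
      using x that \<rho> by (intro tendsto_intros) auto
  qed (use zle[OF that] in auto)
  \<comment> \<open>A row \<open>i\<close> with \<open>x i = 0\<close> has right-hand side 0, so no
    nonzero entry can lead from the zero set to a positive coordinate. The zero set is proper
    because the coordinates sum to 1.\<close>
  define S where "S = {i. i < n \<and> x i = 0}"
  have "S = {}"
  proof (rule ccontr)
    assume "S \<noteq> {}"
    moreover have "S \<noteq> {..<dim_row A}"
    proof
      assume "S = {..<dim_row A}"
      then have "(\<Sum>i<n. x i) = (\<Sum>i<n. 0)" using A by (intro sum.cong) (auto simp: S_def)
      then show False using xsum by simp
    qed
    moreover have "S \<subseteq> {..<dim_row A}" using A by (auto simp: S_def)
    ultimately obtain i j where ij: "i \<in> S" "j < n" "j \<notin> S" "A $$ (i, j) \<noteq> 0"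
      using irreducible_matrixD[OF irr] A by (metis carrier_matD(1))
    have i: "i < n" "x i = 0" using ij by (auto simp: S_def)
    have "0 < A $$ (i, j) * x j"
      using ij i nonneg[of i j] x0[of j] by (auto simp: S_def less_le)
    also have "\<dots> \<le> (\<Sum>j<n. A $$ (i, j) * x j)"
      using nonneg x0 i ij by (intro member_le_sum) auto
    also have "\<dots> \<le> 0" using xle[OF i(1)] i by simp
    finally show False by simp
  qed
  then have "0 < x i" if "i < n" for i using x0[OF that] that by (force simp: S_def)
  then have "positive_supersolution A r x"
    using xle A by (simp add: positive_supersolution_def)
  then show thesis using that by (simp add: r_def)
qed

text \<open>A strict row of a supersolution at the spectral radius propagates along nonzero entries:
  slightly decreasing the coordinate of a strict row keeps that row strict and makes every row
  that uses it strict. Once all rows are strict, the bound could be lowered below the spectral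
  radius.\<close>

lemma irreducible_supersolution_eq:
  assumes A: "A \<in> carrier_mat n n" and n: "n > 0" and nn: "nonneg_matrix A"
    and irr: "irreducible_matrix A"
    and x: "positive_supersolution A (real_spectral_radius A) x" and i: "i < n"
  shows "(\<Sum>j<n. A $$ (i, j) * x j) = real_spectral_radius A * x i"
proof (rule ccontr)
  define r where "r = real_spectral_radius A"
  have r0: "0 \<le> r" unfolding r_def by (rule real_spectral_radius_nonneg[OF A n])
  have nonneg: "0 \<le> A $$ (i, j)" if "i < n" "j < n" for i j
    using nn A that by (auto simp: nonneg_matrix_def)
  define tight where "tight x = {i. i < n \<and> (\<Sum>j<n. A $$ (i, j) * x j) = r * x i}" for x
  \<comment> \<open>Induction on the number of rows with equality, for arbitrary \<open>x\<close>,
    because the vector is modified in each round.\<close>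
  have False if "positive_supersolution A r x" "tight x \<noteq> {..<n}" for x
    using that
  proof (induction "card (tight x)" arbitrary: x rule: less_induct)
    case less
    have xpos: "0 < x i" and xle: "(\<Sum>j<n. A $$ (i, j) * x j) \<le> r * x i" if "i < n" for i
      using less.prems(1) A that by (auto simp: positive_supersolution_def)
    show False
    proof (cases "tight x = {}")
      case True
      define \<rho> where "\<rho> = Max ((\<lambda>i. (\<Sum>j<n. A $$ (i, j) * x j) / x i) ` {..<n})"
      have "positive_supersolution A \<rho> x"
        unfolding positive_supersolution_def
      proof (intro allI impI conjI)
        fix i assume "i < dim_row A"
        then have i: "i < n" using A by simp
        show "0 < x i" by (rule xpos[OF i])
        have "(\<Sum>j<n. A $$ (i, j) * x j) / x i \<le> \<rho>" unfolding \<rho>_def using i by auto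
        then show "(\<Sum>j<dim_row A. A $$ (i, j) * x j) \<le> \<rho> * x i"
          using xpos[OF i] A by (simp add: field_simps)
      qed
      then have "r \<le> \<rho>" unfolding r_def by (rule real_spectral_radius_le[OF A n nn])
      moreover have "\<rho> \<in> (\<lambda>i. (\<Sum>j<n. A $$ (i, j) * x j) / x i) ` {..<n}"
        unfolding \<rho>_def using n by (intro Max_in) auto
      then obtain i where i: "i < n" "\<rho> = (\<Sum>j<n. A $$ (i, j) * x j) / x i" by auto
      have "(\<Sum>j<n. A $$ (i, j) * x j) < r * x i" using xle[OF i(1)] True i by (force simp: tight_def)
      then have "\<rho> < r" unfolding i(2) using xpos[OF i(1)] by (simp add: pos_divide_less_eq)
      ultimately show False by simp
    next
      case False
      have "tight x \<subseteq> {..<dim_row A}" "tight x \<noteq> {..<dim_row A}"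
        using A less.prems by (auto simp: tight_def)
      then obtain i j where ij: "i \<in> tight x" "j < n" "j \<notin> tight x" "A $$ (i, j) \<noteq> 0"
        using irreducible_matrixD[OF irr _ False] A by (metis carrier_matD(1))
      have i: "i < n" using ij by (simp add: tight_def)
      define s where "s = r * x j - (\<Sum>k<n. A $$ (j, k) * x k)"
      have s: "s > 0" using xle[OF ij(2)] ij by (auto simp: s_def tight_def)
      \<comment> \<open>The first bound keeps coordinate \<open>j\<close> positive and the second
        keeps row \<open>j\<close> strict; the denominator \<open>r + 1\<close> stays positive when
        \<open>r = 0\<close>.\<close>
      define \<epsilon> where "\<epsilon> = min (x j / 2) (s / (r + 1))"
      have \<epsilon>: "0 < \<epsilon>" "\<epsilon> < x j" using xpos[OF ij(2)] s r0 by (auto simp: \<epsilon>_def)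
      have "r * \<epsilon> \<le> r * (s / (r + 1))" using r0 by (intro mult_left_mono) (auto simp: \<epsilon>_def)
      also have "\<dots> < s" using r0 s by (simp add: field_simps)
      finally have r\<epsilon>: "r * \<epsilon> < s" .
      define x' where "x' = x(j := x j - \<epsilon>)"
      have sum': "(\<Sum>l<n. A $$ (k, l) * x' l) = (\<Sum>l<n. A $$ (k, l) * x l) - A $$ (k, j) * \<epsilon>" for k
      proof -
        have "(\<Sum>l<n. A $$ (k, l) * x' l)
            = (\<Sum>l<n. A $$ (k, l) * x l - (if l = j then A $$ (k, j) * \<epsilon> else 0))"
          by (intro sum.cong) (auto simp: x'_def algebra_simps)
        then show ?thesis using ij(2) by (simp add: sum_subtractf)
      qed
      have le': "(\<Sum>l<n. A $$ (k, l) * x' l) \<le> (\<Sum>l<n. A $$ (k, l) * x l)" if "k < n" for k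
        using nonneg[OF that ij(2)] \<epsilon> by (simp add: sum')
      have strict_j: "(\<Sum>l<n. A $$ (j, l) * x' l) < r * x' j"
        using le'[OF ij(2)] r\<epsilon> by (simp add: s_def x'_def algebra_simps)
      have x'le: "(\<Sum>l<n. A $$ (k, l) * x' l) \<le> r * x' k" if "k < n" for k
        using strict_j le'[OF that] xle[OF that] by (cases "k = j") (auto simp: x'_def)
      have ss: "positive_supersolution A r x'"
        using x'le xpos \<epsilon> A by (auto simp: positive_supersolution_def x'_def)
      have sub: "tight x' \<subseteq> tight x"
      proof
        fix k assume "k \<in> tight x'"
        then have k: "k < n" "(\<Sum>l<n. A $$ (k, l) * x' l) = r * x' k" by (auto simp: tight_def)
        then have "k \<noteq> j" using strict_j by auto
        then show "k \<in> tight x"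
          using k le'[OF k(1)] xle[OF k(1)] by (auto simp: tight_def x'_def)
      qed
      have "i \<noteq> j" using ij by auto
      moreover have "0 < A $$ (i, j) * \<epsilon>" using nonneg[OF i ij(2)] ij(4) \<epsilon> by simp
      ultimately have "(\<Sum>l<n. A $$ (i, l) * x' l) < r * x' i"
        unfolding sum' using ij(1) by (simp add: tight_def x'_def)
      then have "i \<notin> tight x'" by (simp add: tight_def)
      then have "tight x' \<subset> tight x" using sub ij(1) by blast
      then have "card (tight x') < card (tight x)"
        by (intro psubset_card_mono) (auto simp: tight_def)
      moreover have "tight x' \<noteq> {..<n}" using \<open>i \<notin> tight x'\<close> i by auto
      ultimately show False using less.hyps ss by blast
    qed
  qed
  moreover assume "(\<Sum>j<n. A $$ (i, j) * x j) \<noteq> real_spectral_radius A * x i"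
  then have "tight x \<noteq> {..<n}" using i by (auto simp: tight_def r_def)
  ultimately show False using x by (simp add: r_def)
qed

section \<open>The case of equality\<close>

text \<open>Equality of the logarithms says that the interpolated vector is a supersolution exactly
  at the radius of the interpolated matrix. By irreducibility it is then an eigenvector, like
  \<open>x\<close> and \<open>y\<close>, and comparing the three eigenvector equations yields
  equality in Hoelder for every row.\<close>

lemma log_convex_eq_imp_const:
  assumes A: "A \<in> carrier_mat n n" and n: "n > 0" and nn: "nonneg_matrix A"
    and r: "0 < real_spectral_radius A" and t: "0 < t" "t < 1"
    and irr: "irreducible_matrix A" "irreducible_matrix (transpose_mat A * A)"
    and eq: "ln (real_spectral_radius (scale_rows (\<lambda>i. (1 - t) * c i + t * d i) A))
      = (1 - t) * ln (real_spectral_radius (scale_rows c A))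
         + t * ln (real_spectral_radius (scale_rows d A))"
  shows "\<exists>k. \<forall>i<n. c i - d i = k"
proof -
  define R where "R c = real_spectral_radius (scale_rows c A)" for c
  have R: "0 < R c" for c
    unfolding R_def by (rule real_spectral_radius_scale_rows_pos[OF A n nn r])
  define e where "e i = (1 - t) * c i + t * d i" for i
  have nonneg: "0 \<le> A $$ (i, j)" if "i < n" "j < n" for i j
    using nn A that by (auto simp: nonneg_matrix_def)
  have Re: "R e = R c powr (1 - t) * R d powr t"
  proof -
    have "ln (R e) = ln (R c powr (1 - t) * R d powr t)"
      using eq R[of c] R[of d] unfolding R_def e_def by (simp add: ln_mult ln_powr)
    then show ?thesis using R[of c] R[of d] R[of e] by (subst (asm) ln_inj_iff) auto
  qed
  have scaled: "scale_rows c A \<in> carrier_mat n n" "nonneg_matrix (scale_rows c A)"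
    "irreducible_matrix (scale_rows c A)" for c
    using A nn irreducible_scale_rows[OF irr(1) A] by auto
  obtain x where x: "positive_supersolution (scale_rows c A) (R c) x"
    unfolding R_def using irreducible_ex_supersolution[OF scaled(1) n scaled(2,3)] .
  obtain y where y: "positive_supersolution (scale_rows d A) (R d) y"
    unfolding R_def using irreducible_ex_supersolution[OF scaled(1) n scaled(2,3)] .
  let ?z = "\<lambda>i. x i powr (1 - t) * y i powr t"
  have z: "positive_supersolution (scale_rows e A) (R e) ?z"
    unfolding Re unfolding e_def
    using R by (intro positive_supersolution_interpolate[OF A nn _ _ x y t]) (auto simp: less_imp_le)
  have xy: "0 < x i" "0 < y i" if "i < n" for i
    using x y that unfolding positive_supersolution_scale_rows[OF A] by auto
  define X where "X i = (\<Sum>j<n. A $$ (i, j) * x j)" for i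
  define Y where "Y i = (\<Sum>j<n. A $$ (i, j) * y j)" for i
  define Z where "Z i = (\<Sum>j<n. A $$ (i, j) * ?z j)" for i
  have eigen: "exp (c i) * (\<Sum>j<n. A $$ (i, j) * x j) = R c * x i"
    if "i < n" "positive_supersolution (scale_rows c A) (R c) x" for i c x
  proof -
    have "(\<Sum>j<n. scale_rows c A $$ (i, j) * x j) = R c * x i"
      unfolding R_def using that
      by (intro irreducible_supersolution_eq[OF scaled(1) n scaled(2,3)]) (auto simp: R_def)
    then show ?thesis using A that(1) by (simp add: sum_distrib_left mult_ac)
  qed
  have eX: "exp (c i) * X i = R c * x i" and eY: "exp (d i) * Y i = R d * y i"
    and eZ: "exp (e i) * Z i = R e * ?z i" if "i < n" for i
    unfolding X_def Y_def Z_def using eigen that x y z by blast+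
  have XY: "0 < X i" "0 < Y i" if "i < n" for i
    using eX[OF that] eY[OF that] R[of c] R[of d] xy[OF that]
    by (metis exp_gt_zero mult_pos_pos zero_less_mult_pos)+
  \<comment> \<open>The factor \<open>exp (e i)\<close> and the radius \<open>R e\<close> are the
    same geometric means of the data for \<open>c\<close> and \<open>d\<close>, so they cancel and
    leave equality in Hoelder.\<close>
  have Z_eq: "Z i = X i powr (1 - t) * Y i powr t" if "i < n" for i
  proof -
    have "exp (e i) * Z i = (R c * x i) powr (1 - t) * (R d * y i) powr t"
      using eZ[OF that] R[of c] R[of d] xy[OF that] by (simp add: Re powr_mult less_imp_le)
    also have "\<dots> = (exp (c i) * X i) powr (1 - t) * (exp (d i) * Y i) powr t"
      using eX[OF that] eY[OF that] by simp
    also have "\<dots> = exp (e i) * (X i powr (1 - t) * Y i powr t)"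
      using XY[OF that] by (simp add: powr_mult e_def exp_add exp_powr_real mult_ac less_imp_le)
    finally show ?thesis by simp
  qed
  have *: "x j / X i = y j / Y i" if "i < n" "j < n" "A $$ (i, j) \<noteq> 0" for i j
    unfolding X_def Y_def
  proof (rule weighted_Holder(2)[OF _ _ _ _ t])
    show "(\<Sum>j<n. A $$ (i, j) * ?z j)
      = (\<Sum>j<n. A $$ (i, j) * x j) powr (1 - t) * (\<Sum>j<n. A $$ (i, j) * y j) powr t"
      using Z_eq[OF that(1)] by (simp add: X_def Y_def Z_def)
    show "0 < A $$ (i, j)" using nonneg[OF that(1,2)] that(3) by simp
  qed (use that nonneg xy in auto)
  have ratio: "y j / x j = Y i / X i" if "i < n" "j < n" "A $$ (i, j) \<noteq> 0" for i j
    using *[OF that] xy[OF that(2)] XY[OF that(1)] by (simp add: field_simps)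
  let ?B = "transpose_mat A * A"
  have q: "y j / x j = y 0 / x 0" if "j < n" for j
  proof -
    \<comment> \<open>A nonzero entry \<open>(j, k)\<close> of \<open>transpose_mat A * A\<close>
      comes from a row whose support contains both \<open>j\<close> and \<open>k\<close>, hence the
      two ratios agree and no such entry leaves \<open>S\<close>.\<close>
    define S where "S = {j. j < n \<and> y j / x j = y 0 / x 0}"
    have "S = {..<dim_row ?B}"
    proof (rule ccontr)
      assume "S \<noteq> {..<dim_row ?B}"
      moreover have "S \<subseteq> {..<dim_row ?B}" "S \<noteq> {}" using A n by (auto simp: S_def)
      ultimately obtain j k where jk: "j \<in> S" "k < n" "k \<notin> S" "?B $$ (j, k) \<noteq> 0"
        using irreducible_matrixD[OF irr(2)] A by (metis carrier_matD(2) index_mult_mat(2) index_transpose_mat(2))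
      have j: "j < n" using jk by (simp add: S_def)
      have "?B $$ (j, k) = (\<Sum>i<n. A $$ (i, j) * A $$ (i, k))"
        using A j jk(2) by (simp add: scalar_prod_def atLeast0LessThan)
      then obtain i where "i < n" "A $$ (i, j) * A $$ (i, k) \<noteq> 0"
        using jk(4) by (auto elim!: sum.not_neutral_contains_not_neutral)
      then have "y j / x j = y k / x k" using ratio[of i j] ratio[of i k] j jk(2) by auto
      then show False using jk by (auto simp: S_def)
    qed
    then show ?thesis using that A by (auto simp: S_def)
  qed
  define \<kappa> where "\<kappa> = y 0 / x 0"
  have \<kappa>: "0 < \<kappa>" using xy[OF n] by (simp add: \<kappa>_def)
  have y\<kappa>: "y j = \<kappa> * x j" if "j < n" for j
    using q[OF that] xy[OF that] by (simp add: \<kappa>_def[symmetric] divide_eq_eq)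
  \<comment> \<open>Since \<open>y\<close> is a multiple of \<open>x\<close>, the vector
    \<open>x\<close> is an eigenvector for both scalings; dividing the two equations of row
    \<open>i\<close> leaves only the exponentials and the radii.\<close>
  have "c i - d i = ln (R c / R d)" if "i < n" for i
  proof -
    have "Y i = \<kappa> * X i"
      unfolding X_def Y_def sum_distrib_left using y\<kappa> by (intro sum.cong) (auto simp: mult_ac)
    then have "\<kappa> * (exp (d i) * X i) = \<kappa> * (R d * x i)"
      using eY[OF that] y\<kappa>[OF that] by (simp add: mult_ac)
    then have dX: "exp (d i) * X i = R d * x i" using \<kappa> by simp
    have "(exp (c i) * R d) * (X i * x i) = (exp (c i) * X i) * (R d * x i)" by (simp add: mult_ac)
    also have "\<dots> = (R c * exp (d i)) * (X i * x i)"
      unfolding eX[OF that] dX[symmetric] by (simp add: mult_ac)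
    finally have "exp (c i) * R d = R c * exp (d i)" using XY[OF that] xy[OF that] by simp
    then have "exp (c i - d i) = R c / R d" using R[of d] by (simp add: exp_diff field_simps)
    then show ?thesis by (metis ln_exp)
  qed
  then show ?thesis by blast
qed

section \<open>Reducible matrices: block triangular form\<close>

text \<open>Entries outside the block are set to zero instead of deleted, so a block keeps the index
  set of \<open>A\<close> and can be compared with it entrywise.\<close>

definition restrict_mat :: "nat set \<Rightarrow> real mat \<Rightarrow> real mat" where
  "restrict_mat S A =
     mat (dim_row A) (dim_col A) (\<lambda>(i, j). if i \<in> S \<and> j \<in> S then A $$ (i, j) else 0)"

text \<open>Glue supersolutions of the two blocks, with the one on \<open>S\<close> multiplied by a
  small \<epsilon>. Rows in \<open>S\<close> see only \<open>S\<close>; rows in \<open>T\<close>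
  receive an extra amount of at most \<open>\<epsilon> * b i\<close>, which fits into the gap
  between \<sigma> and \<rho>.\<close>

lemma real_spectral_radius_block_triangular_le:
  assumes A: "A \<in> carrier_mat n n" and n: "n > 0" and nn: "nonneg_matrix A"
    and ST: "S \<inter> T = {}" "S \<union> T = {..<n}"
    and zero: "\<And>i j. i \<in> S \<Longrightarrow> j \<in> T \<Longrightarrow> A $$ (i, j) = 0"
  shows "real_spectral_radius A
    \<le> max (real_spectral_radius (restrict_mat S A)) (real_spectral_radius (restrict_mat T A))"
proof (rule dense_ge)
  fix \<rho> assume \<rho>: "max (real_spectral_radius (restrict_mat S A))
    (real_spectral_radius (restrict_mat T A)) < \<rho>"
  let ?AS = "restrict_mat S A" and ?AT = "restrict_mat T A"
  have nonneg: "0 \<le> A $$ (i, j)" if "i < n" "j < n" for i j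
    using nn A that by (auto simp: nonneg_matrix_def)
  have carrier: "?AS \<in> carrier_mat n n" "?AT \<in> carrier_mat n n"
    using A by (auto simp: restrict_mat_def)
  have nnST: "nonneg_matrix ?AS" "nonneg_matrix ?AT"
    using nn by (auto simp: restrict_mat_def nonneg_matrix_def)
  have entry: "?AS $$ (i, j) = (if i \<in> S \<and> j \<in> S then A $$ (i, j) else 0)"
    "?AT $$ (i, j) = (if i \<in> T \<and> j \<in> T then A $$ (i, j) else 0)" if "i < n" "j < n" for i j
    using A that by (auto simp: restrict_mat_def)
  have "real_spectral_radius ?AS < \<rho>" using \<rho> by simp
  then obtain x where "positive_supersolution ?AS \<rho> x"
    by (rule ex_positive_supersolution[OF carrier(1) n nnST(1)])
  then have x: "0 < x i" "(\<Sum>j<n. ?AS $$ (i, j) * x j) \<le> \<rho> * x i" if "i < n" for i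
    using that carrier(1) by (auto simp: positive_supersolution_def)
  have "real_spectral_radius ?AT < \<rho>" using \<rho> by simp
  then obtain \<sigma> where \<sigma>: "real_spectral_radius ?AT < \<sigma>" "\<sigma> < \<rho>" using dense by blast
  obtain y where "positive_supersolution ?AT \<sigma> y"
    using \<sigma>(1) by (rule ex_positive_supersolution[OF carrier(2) n nnST(2)])
  then have y: "0 < y i" "(\<Sum>j<n. ?AT $$ (i, j) * y j) \<le> \<sigma> * y i" if "i < n" for i
    using that carrier(2) by (auto simp: positive_supersolution_def)
  define b where "b i = (\<Sum>j<n. A $$ (i, j) * x j)" for i
  have b0: "0 \<le> b i" if "i < n" for i
    unfolding b_def using that nonneg x by (auto intro!: sum_nonneg simp: less_imp_le)
  \<comment> \<open>The sum is a crude common bound for all the ratios; any \<epsilon> with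
    \<open>\<epsilon> * K \<le> 1\<close> is small enough.\<close>
  define K where "K = (\<Sum>i<n. b i / ((\<rho> - \<sigma>) * y i))"
  have bK: "b i \<le> K * ((\<rho> - \<sigma>) * y i)" if "i < n" for i
  proof -
    have "b i / ((\<rho> - \<sigma>) * y i) \<le> K"
      unfolding K_def using that b0 y \<sigma> by (intro member_le_sum) (auto simp: less_imp_le)
    then show ?thesis using y(1)[OF that] \<sigma> by (simp add: pos_divide_le_eq)
  qed
  have K0: "0 \<le> K"
    unfolding K_def using b0 y \<sigma> by (intro sum_nonneg) (auto simp: less_imp_le)
  define \<epsilon> where "\<epsilon> = 1 / (1 + K)"
  have \<epsilon>: "0 < \<epsilon>" "\<epsilon> * K \<le> 1" using K0 by (auto simp: \<epsilon>_def)
  have \<epsilon>b: "\<epsilon> * b i \<le> (\<rho> - \<sigma>) * y i" if "i < n" for i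
  proof -
    have "\<epsilon> * b i \<le> \<epsilon> * K * ((\<rho> - \<sigma>) * y i)"
      using bK[OF that] \<epsilon> by (simp add: mult.assoc)
    also have "\<dots> \<le> 1 * ((\<rho> - \<sigma>) * y i)"
      using \<epsilon>(2) y(1)[OF that] \<sigma> by (intro mult_right_mono) (auto simp: less_imp_le)
    finally show ?thesis by simp
  qed
  define z where "z i = (if i \<in> S then \<epsilon> * x i else y i)" for i
  have "positive_supersolution A \<rho> z"
    unfolding positive_supersolution_def
  proof (intro allI impI conjI)
    fix i assume "i < dim_row A"
    then have i: "i < n" using A by simp
    show "0 < z i" using x(1)[OF i] y(1)[OF i] \<epsilon> by (simp add: z_def)
    have "(\<Sum>j<n. A $$ (i, j) * z j) \<le> \<rho> * z i"
    proof (cases "i \<in> S")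
      case True
      have "(\<Sum>j<n. A $$ (i, j) * z j) = (\<Sum>j<n. \<epsilon> * (?AS $$ (i, j) * x j))"
      proof (rule sum.cong[OF refl])
        fix j assume "j \<in> {..<n}"
        then show "A $$ (i, j) * z j = \<epsilon> * (?AS $$ (i, j) * x j)"
          using True zero[of i j] ST i by (auto simp: entry z_def)
      qed
      also have "\<dots> = \<epsilon> * (\<Sum>j<n. ?AS $$ (i, j) * x j)" by (simp add: sum_distrib_left)
      also have "\<dots> \<le> \<epsilon> * (\<rho> * x i)" using x(2)[OF i] \<epsilon> by (intro mult_left_mono) auto
      finally show ?thesis using True by (simp add: z_def mult_ac)
    next
      case False
      then have iT: "i \<in> T" using ST i by auto
      have "(\<Sum>j<n. A $$ (i, j) * z j) \<le> (\<Sum>j<n. \<epsilon> * (A $$ (i, j) * x j) + ?AT $$ (i, j) * y j)"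
      proof (rule sum_mono)
        fix j assume "j \<in> {..<n}"
        then have j: "j < n" by simp
        have "0 \<le> \<epsilon> * (A $$ (i, j) * x j)" using nonneg[OF i j] x(1)[OF j] \<epsilon> by simp
        moreover have "j \<in> S \<or> j \<in> T" using j ST(2) by auto
        ultimately show "A $$ (i, j) * z j \<le> \<epsilon> * (A $$ (i, j) * x j) + ?AT $$ (i, j) * y j"
          using ST(1) iT by (auto simp: entry[OF i j] z_def)
      qed
      also have "\<dots> = \<epsilon> * b i + (\<Sum>j<n. ?AT $$ (i, j) * y j)"
        by (simp add: sum.distrib b_def sum_distrib_left)
      also have "\<dots> \<le> (\<rho> - \<sigma>) * y i + \<sigma> * y i" using \<epsilon>b[OF i] y(2)[OF i] by (rule add_mono)
      finally show ?thesis using False by (simp add: z_def algebra_simps)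
    qed
    then show "(\<Sum>j<dim_row A. A $$ (i, j) * z j) \<le> \<rho> * z i" using A by simp
  qed
  then show "real_spectral_radius A \<le> \<rho>" by (rule real_spectral_radius_le[OF A n nn])
qed

lemma real_spectral_radius_block_triangular:
  assumes A: "A \<in> carrier_mat n n" and n: "n > 0" and nn: "nonneg_matrix A"
    and ST: "S \<inter> T = {}" "S \<union> T = {..<n}"
    and zero: "\<And>i j. i \<in> S \<Longrightarrow> j \<in> T \<Longrightarrow> A $$ (i, j) = 0"
  shows "real_spectral_radius A
    = max (real_spectral_radius (restrict_mat S A)) (real_spectral_radius (restrict_mat T A))"
proof (rule antisym)
  show "real_spectral_radius A
      \<le> max (real_spectral_radius (restrict_mat S A)) (real_spectral_radius (restrict_mat T A))"
    by (rule real_spectral_radius_block_triangular_le[OF assms])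
  have "real_spectral_radius (restrict_mat U A) \<le> real_spectral_radius A" for U
    using A nn n by (intro real_spectral_radius_mono[where n = n])
      (auto simp: restrict_mat_def nonneg_matrix_def)
  then show "max (real_spectral_radius (restrict_mat S A)) (real_spectral_radius (restrict_mat T A))
      \<le> real_spectral_radius A" by simp
qed

text \<open>Scaling the rows in \<open>T\<close> by \<open>exp s\<close> turns the radius into the
  maximum of the radius of the \<open>S\<close> block and \<open>exp s\<close> times that of the
  \<open>T\<close> block. Lowering \<open>T\<close> when \<open>S\<close> dominates (slope 0) and
  raising it otherwise (slope 1) lets the same block dominate for all \<open>t \<ge> 0\<close>; for
  negative \<open>t\<close> the other block could take over.\<close>

lemma reducible_imp_affine_direction:
  assumes A: "A \<in> carrier_mat n n" and n: "n > 0" and nn: "nonneg_matrix A"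
    and r: "0 < real_spectral_radius A" and red: "\<not> irreducible_matrix A"
  shows "\<exists>d b. \<not> (\<exists>k. \<forall>i<n. d i = k) \<and> (\<forall>t\<ge>0.
    real_spectral_radius (scale_rows (\<lambda>i. t * d i) A) = exp (t * b) * real_spectral_radius A)"
proof -
  obtain S T where ST: "S \<noteq> {}" "T \<noteq> {}" "S \<inter> T = {}" "S \<union> T = {..<n}"
    and zero: "\<And>i j. i \<in> S \<Longrightarrow> j \<in> T \<Longrightarrow> A $$ (i, j) = 0"
    using reducible_matrixE[OF red] A by (metis carrier_matD(1))
  let ?AS = "restrict_mat S A" and ?AT = "restrict_mat T A"
  let ?d = "\<lambda>s i. if i \<in> T then s else 0 :: real"
  have lt: "i < n" if "i \<in> S \<or> i \<in> T" for i using ST(4) that by auto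
  have eq: "real_spectral_radius (scale_rows (?d s) A)
      = max (real_spectral_radius ?AS) (exp s * real_spectral_radius ?AT)" for s
  proof -
    have "real_spectral_radius (scale_rows (?d s) A)
      = max (real_spectral_radius (restrict_mat S (scale_rows (?d s) A)))
            (real_spectral_radius (restrict_mat T (scale_rows (?d s) A)))"
      using A n nn zero lt by (intro real_spectral_radius_block_triangular[OF _ _ _ ST(3,4)]) auto
    also have "restrict_mat S (scale_rows (?d s) A) = ?AS"
      using ST(3) by (intro eq_matI) (auto simp: restrict_mat_def scale_rows_def)
    also have "restrict_mat T (scale_rows (?d s) A) = exp s \<cdot>\<^sub>m ?AT"
      by (intro eq_matI) (auto simp: restrict_mat_def scale_rows_def)
    also have "real_spectral_radius \<dots> = exp s * real_spectral_radius ?AT"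
      using A by (intro real_spectral_radius_smult[OF _ n]) (auto simp: restrict_mat_def)
    finally show ?thesis .
  qed
  have rA: "real_spectral_radius A = max (real_spectral_radius ?AS) (real_spectral_radius ?AT)"
    by (rule real_spectral_radius_block_triangular[OF A n nn ST(3,4) zero])
  have AT0: "0 \<le> real_spectral_radius ?AT"
    using A by (intro real_spectral_radius_nonneg[OF _ n]) (auto simp: restrict_mat_def)
  have nonconst: "\<not> (\<exists>k. \<forall>i<n. ?d s i = k)" if "s \<noteq> 0" for s
  proof
    assume "\<exists>k. \<forall>i<n. ?d s i = k"
    then obtain k where k: "\<forall>i<n. ?d s i = k" by blast
    obtain i j where ij: "i \<in> S" "j \<in> T" using ST by blast
    then have "i < n" "j < n" "i \<notin> T" using ST(3) lt by auto
    then have "?d s i = ?d s j" using k by metis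
    then show False using ij \<open>i \<notin> T\<close> that by simp
  qed
  have mult: "(\<lambda>i. t * ?d s i) = ?d (t * s)" for t s by auto
  show ?thesis
  proof (cases "real_spectral_radius ?AT \<le> real_spectral_radius ?AS")
    case True
    have "real_spectral_radius (scale_rows (\<lambda>i. t * ?d (-1) i) A) = exp (t * 0) * real_spectral_radius A"
      if "t \<ge> 0" for t
    proof -
      have "exp (t * (-1)) * real_spectral_radius ?AT \<le> 1 * real_spectral_radius ?AT"
        using that AT0 by (intro mult_right_mono) auto
      then show ?thesis unfolding mult eq rA using True by simp
    qed
    then show ?thesis using nonconst[of "-1"]
      by (intro exI[of _ "?d (-1)"] exI[of _ 0]) auto
  next
    case False
    have "real_spectral_radius (scale_rows (\<lambda>i. t * ?d 1 i) A) = exp (t * 1) * real_spectral_radius A"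
      if "t \<ge> 0" for t
    proof -
      have "1 * real_spectral_radius ?AT \<le> exp (t * 1) * real_spectral_radius ?AT"
        using that AT0 by (intro mult_right_mono) auto
      then show ?thesis unfolding mult eq rA using False by simp
    qed
    then show ?thesis using nonconst[of 1]
      by (intro exI[of _ "?d 1"] exI[of _ 1]) auto
  qed
qed

section \<open>Diagonal similarity and flat directions\<close>

text \<open>Multiplying a supersolution of \<open>A\<close> coordinatewise by
  \<open>exp (p i)\<close> gives one of the conjugated matrix for the same bound. Conjugating back
  with \<open>- p\<close> yields the other inequality.\<close>

lemma real_spectral_radius_diagonal_similarity:
  assumes A: "A \<in> carrier_mat n n" and n: "n > 0" and nn: "nonneg_matrix A"
  shows "real_spectral_radius (mat n n (\<lambda>(i, j). exp (p i - p j) * A $$ (i, j)))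
    = real_spectral_radius A"
proof -
  have le: "real_spectral_radius (mat n n (\<lambda>(i, j). exp (p i - p j) * A $$ (i, j)))
      \<le> real_spectral_radius A"
    if A: "A \<in> carrier_mat n n" and nn: "nonneg_matrix A" for p A
  proof (rule dense_ge)
    fix \<rho> assume "real_spectral_radius A < \<rho>"
    then obtain x where x: "positive_supersolution A \<rho> x"
      by (rule ex_positive_supersolution[OF A n nn])
    let ?B = "mat n n (\<lambda>(i, j). exp (p i - p j) * A $$ (i, j))"
    have "positive_supersolution ?B \<rho> (\<lambda>i. exp (p i) * x i)"
      unfolding positive_supersolution_def
    proof (intro allI impI conjI)
      fix i assume "i < dim_row ?B"
      then have i: "i < n" by simp
      show "0 < exp (p i) * x i" using x A i by (simp add: positive_supersolution_def)
      have "(\<Sum>j<n. ?B $$ (i, j) * (exp (p j) * x j)) = exp (p i) * (\<Sum>j<n. A $$ (i, j) * x j)"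
        unfolding sum_distrib_left using i by (intro sum.cong) (auto simp: exp_diff)
      also have "\<dots> \<le> exp (p i) * (\<rho> * x i)"
        using x A i by (intro mult_left_mono) (auto simp: positive_supersolution_def)
      finally show "(\<Sum>j<dim_row ?B. ?B $$ (i, j) * (exp (p j) * x j)) \<le> \<rho> * (exp (p i) * x i)"
        by (simp add: mult_ac)
    qed
    then show "real_spectral_radius ?B \<le> \<rho>"
      using nn A n by (intro real_spectral_radius_le[where n = n]) (auto simp: nonneg_matrix_def)
  qed
  let ?B = "mat n n (\<lambda>(i, j). exp (p i - p j) * A $$ (i, j))"
  have "real_spectral_radius (mat n n (\<lambda>(i, j). exp (- p i - - p j) * ?B $$ (i, j)))
      \<le> real_spectral_radius ?B"
    using nn A by (intro le) (auto simp: nonneg_matrix_def)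
  moreover have "mat n n (\<lambda>(i, j). exp (- p i - - p j) * ?B $$ (i, j)) = A"
    using A by (intro eq_matI) (auto simp flip: exp_add mult.assoc)
  ultimately have "real_spectral_radius A \<le> real_spectral_radius ?B" by simp
  with le[OF A nn, of p] show ?thesis by (rule antisym)
qed

text \<open>If \<open>transpose_mat A * A\<close> is reducible, every row of \<open>A\<close> is supported in one of the two classes
  of columns, so rescaling the columns of one class can be undone by rescaling rows: the row scaling
  \<open>d\<close> below turns \<open>A\<close> into a matrix that is diagonally similar to \<open>A\<close>.\<close>

lemma reducible_transpose_mult_imp_flat_direction:
  assumes A: "A \<in> carrier_mat n n" and n: "n > 0" and nn: "nonneg_matrix A"
    and r: "0 < real_spectral_radius A" and irr: "irreducible_matrix A"
    and red: "\<not> irreducible_matrix (transpose_mat A * A)"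
  shows "\<exists>d. \<not> (\<exists>k. \<forall>i<n. d i = k) \<and>
    (\<forall>t. real_spectral_radius (scale_rows (\<lambda>i. t * d i) A) = real_spectral_radius A)"
proof -
  let ?B = "transpose_mat A * A"
  have nonneg: "0 \<le> A $$ (i, j)" if "i < n" "j < n" for i j
    using nn A that by (auto simp: nonneg_matrix_def)
  obtain S T where ST: "S \<noteq> {}" "T \<noteq> {}" "S \<inter> T = {}" "S \<union> T = {..<n}"
    and zero: "\<And>i j. i \<in> S \<Longrightarrow> j \<in> T \<Longrightarrow> ?B $$ (i, j) = 0"
    using reducible_matrixE[OF red] A by (metis carrier_matD(2) index_mult_mat(2) index_transpose_mat(2))
  define p where "p j = (if j \<in> T then 1 else 0 :: real)" for j
  \<comment> \<open>\<open>q i\<close> is the value of \<open>p\<close> on the support of row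
    \<open>i\<close>, which lies in one class, so the chosen index is immaterial; for a zero row
    \<open>p i\<close> is a mere default.\<close>
  define q where "q i = (if \<exists>j<n. A $$ (i, j) \<noteq> 0 then p (SOME j. j < n \<and> A $$ (i, j) \<noteq> 0) else p i)" for i
  have orth: "A $$ (i, j) = 0 \<or> A $$ (i, k) = 0" if "i < n" "j \<in> S" "k \<in> T" for i j k
  proof -
    have jk: "j < n" "k < n" using that ST(4) by auto
    have "?B $$ (j, k) = (\<Sum>i<n. A $$ (i, j) * A $$ (i, k))"
      using A jk by (simp add: scalar_prod_def atLeast0LessThan)
    then have "(\<Sum>i<n. A $$ (i, j) * A $$ (i, k)) = 0" using zero[OF that(2,3)] by simp
    then have "A $$ (i, j) * A $$ (i, k) = 0"
      using that(1) nonneg jk by (subst (asm) sum_nonneg_eq_0_iff) auto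
    then show ?thesis by simp
  qed
  have q: "q i = p j" if "i < n" "j < n" "A $$ (i, j) \<noteq> 0" for i j
  proof -
    define k where "k = (SOME j. j < n \<and> A $$ (i, j) \<noteq> 0)"
    have k: "k < n \<and> A $$ (i, k) \<noteq> 0"
      unfolding k_def by (rule someI[of _ j]) (use that in auto)
    then have "q i = p k" using that by (auto simp: q_def k_def)
    moreover have "(j \<in> S \<or> j \<in> T) \<and> (k \<in> S \<or> k \<in> T)" using that k ST(4) by auto
    ultimately show ?thesis
      using orth[OF that(1), of j k] orth[OF that(1), of k j] that(3) k ST(3) by (auto simp: p_def)
  qed
  define d where "d i = p i - q i" for i
  have flat: "real_spectral_radius (scale_rows (\<lambda>i. t * d i) A) = real_spectral_radius A" for t
  proof -
    have "scale_rows (\<lambda>i. t * d i) A = mat n n (\<lambda>(i, j). exp (t * p i - t * p j) * A $$ (i, j))"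
    proof (rule eq_matI)
      fix i j assume "i < dim_row (mat n n (\<lambda>(i, j). exp (t * p i - t * p j) * A $$ (i, j)))"
        "j < dim_col (mat n n (\<lambda>(i, j). exp (t * p i - t * p j) * A $$ (i, j)))"
      then have "i < n" "j < n" by auto
      then show "scale_rows (\<lambda>i. t * d i) A $$ (i, j)
          = mat n n (\<lambda>(i, j). exp (t * p i - t * p j) * A $$ (i, j)) $$ (i, j)"
        using A q[of i j] by (cases "A $$ (i, j) = 0") (auto simp: d_def right_diff_distrib)
    qed (use A in auto)
    then show ?thesis using real_spectral_radius_diagonal_similarity[OF A n nn] by simp
  qed
  \<comment> \<open>A constant \<open>d\<close> would multiply the radius by \<open>exp k\<close>,
    so flatness forces \<open>k = 0\<close> and \<open>q\<close> agrees with \<open>p\<close>.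
    Irreducibility of \<open>A\<close> provides a nonzero entry from \<open>S\<close> to
    \<open>T\<close>, along which \<open>p\<close> would have to take equal values.\<close>
  have "\<not> (\<exists>k. \<forall>i<n. d i = k)"
  proof
    assume "\<exists>k. \<forall>i<n. d i = k"
    then obtain k where k: "\<forall>i<n. d i = k" by blast
    have "scale_rows (\<lambda>i. 1 * d i) A = exp k \<cdot>\<^sub>m scale_rows (\<lambda>i. 0) A"
      using k A by (intro scale_rows_const_add) auto
    also have "scale_rows (\<lambda>i. 0) A = A" by (rule scale_rows_zero) simp
    finally have "real_spectral_radius A = exp k * real_spectral_radius A"
      using flat[of 1] real_spectral_radius_smult[OF A n, of "exp k"] by simp
    then have "k = 0" using r by simp
    have "S \<subseteq> {..<dim_row A}" "S \<noteq> {..<dim_row A}" using ST A by auto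
    then obtain i j where ij: "i \<in> S" "j < n" "j \<notin> S" "A $$ (i, j) \<noteq> 0"
      using irreducible_matrixD[OF irr _ ST(1)] A by (metis carrier_matD(1))
    have "i < n" "j \<in> T" "i \<notin> T" using ij ST(3,4) by auto
    then have "p i = p j" using k q[of i j] ij \<open>k = 0\<close> by (auto simp: d_def)
    then show False using \<open>j \<in> T\<close> \<open>i \<notin> T\<close> by (simp add: p_def)
  qed
  then show ?thesis using flat by blast
qed

section \<open>Back to diagonal matrices and the matrix exponential\<close>

lemma mat_exp_diagonal_mult:
  assumes C: "C \<in> diagonal_mats n" and A: "A \<in> carrier_mat n n"
  shows "mat_exp C * A = scale_rows (\<lambda>i. C $$ (i, i)) A"
proof (rule eq_matI)
  fix i j assume "i < dim_row (scale_rows (\<lambda>i. C $$ (i, i)) A)"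
    "j < dim_col (scale_rows (\<lambda>i. C $$ (i, i)) A)"
  then have ij: "i < n" "j < n" using A by auto
  have "(mat_exp C * A) $$ (i, j)
      = (\<Sum>k<n. (if i = k then exp (C $$ (i, i)) else 0) * A $$ (k, j))"
    using A ij by (simp add: mat_exp_diagonal[OF C] scalar_prod_def atLeast0LessThan)
  also have "\<dots> = (\<Sum>k<n. if i = k then exp (C $$ (i, i)) * A $$ (i, j) else 0)"
    by (intro sum.cong) auto
  also have "\<dots> = exp (C $$ (i, i)) * A $$ (i, j)" using ij by simp
  finally show "(mat_exp C * A) $$ (i, j) = scale_rows (\<lambda>i. C $$ (i, i)) A $$ (i, j)"
    using A ij by simp
qed (use A in \<open>auto simp: mat_exp_diagonal[OF C]\<close>)

lemma scalar_matrix_diff_iff: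
  assumes C: "C \<in> diagonal_mats n" and D: "D \<in> diagonal_mats n"
  shows "scalar_matrix (C - D) \<longleftrightarrow> (\<exists>k. \<forall>i<n. C $$ (i, i) - D $$ (i, i) = k)"
proof
  have CD: "C \<in> carrier_mat n n" "D \<in> carrier_mat n n" using C D by (auto simp: diagonal_mats_def)
  {
    assume "scalar_matrix (C - D)"
    then obtain k where k: "C - D = k \<cdot>\<^sub>m 1\<^sub>m n" using CD by (auto simp: scalar_matrix_def)
    have "C $$ (i, i) - D $$ (i, i) = k" if "i < n" for i
      using arg_cong[OF k, of "\<lambda>M. M $$ (i, i)"] CD that by simp
    then show "\<exists>k. \<forall>i<n. C $$ (i, i) - D $$ (i, i) = k" by blast
  }
  assume "\<exists>k. \<forall>i<n. C $$ (i, i) - D $$ (i, i) = k"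
  then obtain k where "\<forall>i<n. C $$ (i, i) - D $$ (i, i) = k" by blast
  then have "C - D = k \<cdot>\<^sub>m 1\<^sub>m n"
    using C D CD by (intro eq_matI) (auto simp: diagonal_mats_def diagonal_mat_def)
  then show "scalar_matrix (C - D)" unfolding scalar_matrix_def using CD by auto
qed

lemma ex_diagonal_mat: "\<exists>C\<in>diagonal_mats n. \<forall>i<n. C $$ (i, i) = c i"
  by (rule bexI[of _ "mat n n (\<lambda>(i, j). if i = j then c i else 0)"])
    (auto simp: diagonal_mats_def diagonal_mat_def)

lemma scale_rows_cong:
  "(\<And>i. i < dim_row A \<Longrightarrow> c i = d i) \<Longrightarrow> scale_rows c A = scale_rows d A"
  by (auto simp: scale_rows_def)

theorem theorem11:
  fixes n :: nat and A :: "real mat"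
  assumes "n \<ge> 1"
    and "A \<in> carrier_mat n n"
    and "nonneg_matrix A"
    and "real_spectral_radius A > 0"
  shows
    "(\<forall>C\<in>diagonal_mats n. \<forall>D\<in>diagonal_mats n. \<forall>t\<in>{0<..<1}.
        ln (real_spectral_radius (mat_exp ((1 - t) \<cdot>\<^sub>m C + t \<cdot>\<^sub>m D) * A))
          \<le> (1 - t) * ln (real_spectral_radius (mat_exp C * A))
             + t * ln (real_spectral_radius (mat_exp D * A)))
     \<and> (\<forall>C\<in>diagonal_mats n. \<forall>D\<in>diagonal_mats n. \<forall>t\<in>{0<..<1}.
        scalar_matrix (C - D) \<longrightarrow>
        ln (real_spectral_radius (mat_exp ((1 - t) \<cdot>\<^sub>m C + t \<cdot>\<^sub>m D) * A))
          = (1 - t) * ln (real_spectral_radius (mat_exp C * A))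
             + t * ln (real_spectral_radius (mat_exp D * A)))
     \<and> ((irreducible_matrix A \<and> irreducible_matrix (transpose_mat A * A))
        \<longleftrightarrow>
        (\<forall>C\<in>diagonal_mats n. \<forall>D\<in>diagonal_mats n. \<forall>t\<in>{0<..<1}.
           ln (real_spectral_radius (mat_exp ((1 - t) \<cdot>\<^sub>m C + t \<cdot>\<^sub>m D) * A))
             = (1 - t) * ln (real_spectral_radius (mat_exp C * A))
                + t * ln (real_spectral_radius (mat_exp D * A))
           \<longrightarrow> scalar_matrix (C - D)))
     \<and> ((irreducible_matrix A \<and> irreducible_matrix (transpose_mat A * A))
        \<longleftrightarrow>
        (\<forall>C\<in>diagonal_mats n. \<forall>D\<in>diagonal_mats n.
           \<not> scalar_matrix (C - D) \<longrightarrow>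
           (\<forall>t\<in>{0<..<1}.
              ln (real_spectral_radius (mat_exp ((1 - t) \<cdot>\<^sub>m C + t \<cdot>\<^sub>m D) * A))
                < (1 - t) * ln (real_spectral_radius (mat_exp C * A))
                   + t * ln (real_spectral_radius (mat_exp D * A)))))"
proof -
  have n: "n > 0" and A: "A \<in> carrier_mat n n" and nn: "nonneg_matrix A"
    and r: "0 < real_spectral_radius A" using assms by auto
  \<comment> \<open>\<open>L\<close> works with diagonals as functions, while \<open>F\<close> and
    \<open>mix\<close> mirror the expressions of the theorem and are unfolded only at the very
    end.\<close>
  define L where "L c = ln (real_spectral_radius (scale_rows c A))" for c
  define F where "F C = ln (real_spectral_radius (mat_exp C * A))" for C
  define mix where "mix t C D = (1 - t) \<cdot>\<^sub>m C + t \<cdot>\<^sub>m D" for t :: real and C D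
  have F: "F C = L (\<lambda>i. C $$ (i, i))" if "C \<in> diagonal_mats n" for C
    unfolding F_def L_def mat_exp_diagonal_mult[OF that A] ..
  have Fmix: "F (mix t C D) = L (\<lambda>i. (1 - t) * C $$ (i, i) + t * D $$ (i, i))"
    if "C \<in> diagonal_mats n" "D \<in> diagonal_mats n" for C D t
  proof -
    have "mix t C D \<in> diagonal_mats n"
      using that by (auto simp: mix_def diagonal_mats_def diagonal_mat_def)
    then have "F (mix t C D) = L (\<lambda>i. mix t C D $$ (i, i))" by (rule F)
    also have "scale_rows (\<lambda>i. mix t C D $$ (i, i)) A
        = scale_rows (\<lambda>i. (1 - t) * C $$ (i, i) + t * D $$ (i, i)) A"
      using that A by (intro scale_rows_cong) (auto simp: mix_def diagonal_mats_def)
    then have "L (\<lambda>i. mix t C D $$ (i, i)) = L (\<lambda>i. (1 - t) * C $$ (i, i) + t * D $$ (i, i))"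
      by (simp add: L_def)
    finally show ?thesis .
  qed
  have convex: "F (mix t C D) \<le> (1 - t) * F C + t * F D"
    if "C \<in> diagonal_mats n" "D \<in> diagonal_mats n" "t \<in> {0<..<1}" for C D t
    unfolding Fmix[OF that(1,2)] unfolding F[OF that(1)] F[OF that(2)] L_def
    using that(3) by (intro real_spectral_radius_log_convex[OF A n nn r]) auto
  have L_add: "L c = k + L d" if "\<And>i. i < n \<Longrightarrow> c i = k + d i" for c d k
  proof -
    have "scale_rows c A = exp k \<cdot>\<^sub>m scale_rows d A"
      using that A by (intro scale_rows_const_add) auto
    then show ?thesis
      using A n real_spectral_radius_scale_rows_pos[OF A n nn r, THEN less_imp_neq, of d]
      by (simp add: L_def real_spectral_radius_smult[where n = n] ln_mult)
  qed
  have scalar: "F (mix t C D) = (1 - t) * F C + t * F D"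
    if CD: "C \<in> diagonal_mats n" "D \<in> diagonal_mats n" and "scalar_matrix (C - D)" for C D t
  proof -
    obtain k where "\<forall>i<n. C $$ (i, i) - D $$ (i, i) = k"
      using \<open>scalar_matrix (C - D)\<close> unfolding scalar_matrix_diff_iff[OF CD] ..
    then have k: "C $$ (i, i) = k + D $$ (i, i)" if "i < n" for i using that by force
    have "F C = k + F D" unfolding F[OF CD(1)] F[OF CD(2)] by (rule L_add) (rule k)
    moreover have "F (mix t C D) = (1 - t) * k + F D"
      unfolding Fmix[OF CD] unfolding F[OF CD(2)]
      by (rule L_add) (simp add: k algebra_simps)
    ultimately show ?thesis by (simp add: algebra_simps)
  qed
  let ?irr = "irreducible_matrix A \<and> irreducible_matrix (transpose_mat A * A)"
  have strict: "scalar_matrix (C - D)"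
    if CD: "C \<in> diagonal_mats n" "D \<in> diagonal_mats n" and t: "t \<in> {0<..<1}" and irr: ?irr
      and eq: "F (mix t C D) = (1 - t) * F C + t * F D" for C D t
    unfolding scalar_matrix_diff_iff[OF CD]
    using eq t irr unfolding Fmix[OF CD] unfolding F[OF CD(1)] F[OF CD(2)] L_def
    by (intro log_convex_eq_imp_const[OF A n nn r]) auto
  \<comment> \<open>If (a) fails, \<open>L\<close> is affine on a ray from 0 in a nonconstant
    direction \<open>d\<close>. Taking \<open>d\<close> as the diagonal of \<open>C\<close>, the
    zero matrix as \<open>D\<close> and \<open>t = 1 / 2\<close> gives equality at the
    midpoint.\<close>
  have converse: "\<exists>C\<in>diagonal_mats n. \<exists>D\<in>diagonal_mats n. \<exists>t\<in>{0<..<1}.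
      F (mix t C D) = (1 - t) * F C + t * F D \<and> \<not> scalar_matrix (C - D)" if "\<not> ?irr"
  proof -
    have "\<exists>d b. \<not> (\<exists>k. \<forall>i<n. d i = k) \<and> (\<forall>t\<ge>0.
        real_spectral_radius (scale_rows (\<lambda>i. t * d i) A) = exp (t * b) * real_spectral_radius A)"
    proof (cases "irreducible_matrix A")
      case True
      with \<open>\<not> ?irr\<close> have "\<not> irreducible_matrix (transpose_mat A * A)" by blast
      from reducible_transpose_mult_imp_flat_direction[OF A n nn r True this]
      obtain d where "\<not> (\<exists>k. \<forall>i<n. d i = k)"
        "\<forall>t. real_spectral_radius (scale_rows (\<lambda>i. t * d i) A) = real_spectral_radius A"
        by (elim exE conjE)
      then show ?thesis by (intro exI[of _ d] exI[of _ 0]) simp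
    qed (rule reducible_imp_affine_direction[OF A n nn r])
    then obtain d b where db: "\<not> (\<exists>k. \<forall>i<n. d i = k) \<and> (\<forall>t\<ge>0.
        real_spectral_radius (scale_rows (\<lambda>i. t * d i) A) = exp (t * b) * real_spectral_radius A)"
      by (elim exE)
    then have d: "\<not> (\<exists>k. \<forall>i<n. d i = k)" ..
    have Ld: "L (\<lambda>i. t * d i) = t * b + ln (real_spectral_radius A)" if "t \<ge> 0" for t
      using db that r by (simp add: L_def ln_mult)
    obtain C where C: "C \<in> diagonal_mats n" "\<And>i. i < n \<Longrightarrow> C $$ (i, i) = d i"
      using ex_diagonal_mat[of n d] by blast
    obtain D where D: "D \<in> diagonal_mats n" "\<And>i. i < n \<Longrightarrow> D $$ (i, i) = 0"
      using ex_diagonal_mat[of n "\<lambda>_. 0"] by blast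
    have "F C = L (\<lambda>i. 1 * d i)"
      unfolding F[OF C(1)] L_def using C A by (subst scale_rows_cong) auto
    moreover have "F D = L (\<lambda>i. 0 * d i)"
      unfolding F[OF D(1)] L_def using D A by (subst scale_rows_cong) auto
    moreover have "F (mix (1 / 2) C D) = L (\<lambda>i. 1 / 2 * d i)"
      unfolding Fmix[OF C(1) D(1)] L_def using C D A by (subst scale_rows_cong) auto
    ultimately have "F (mix (1 / 2) C D) = (1 - 1 / 2) * F C + 1 / 2 * F D"
      using Ld[of 1] Ld[of 0] Ld[of "1 / 2"] by (simp add: field_simps)
    moreover have "\<not> scalar_matrix (C - D)"
      using d C D by (simp add: scalar_matrix_diff_iff)
    ultimately show ?thesis using C(1) D(1)
      by (intro bexI[of _ C] bexI[of _ D] bexI[of _ "1 / 2"]) auto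
  qed
  have b: "?irr \<longleftrightarrow> (\<forall>C\<in>diagonal_mats n. \<forall>D\<in>diagonal_mats n. \<forall>t\<in>{0<..<1}.
      F (mix t C D) = (1 - t) * F C + t * F D \<longrightarrow> scalar_matrix (C - D))" (is "_ \<longleftrightarrow> ?b")
  proof
    assume ?irr
    then show ?b by (intro ballI impI) (rule strict)
  next
    assume ?b
    then show ?irr using converse by blast
  qed
  \<comment> \<open>By convexity strict inequality is the same as failure of equality, so (b) and
    (c) are contrapositives for each pair \<open>C\<close>, \<open>D\<close>.\<close>
  have "?b \<longleftrightarrow> (\<forall>C\<in>diagonal_mats n. \<forall>D\<in>diagonal_mats n. \<not> scalar_matrix (C - D) \<longrightarrow>
      (\<forall>t\<in>{0<..<1}. F (mix t C D) < (1 - t) * F C + t * F D))"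
  proof (intro ball_cong refl)
    fix C D assume "C \<in> diagonal_mats n" "D \<in> diagonal_mats n"
    from convex[OF this]
    show "(\<forall>t\<in>{0<..<1}. F (mix t C D) = (1 - t) * F C + t * F D \<longrightarrow> scalar_matrix (C - D))
      \<longleftrightarrow> (\<not> scalar_matrix (C - D) \<longrightarrow>
        (\<forall>t\<in>{0<..<1}. F (mix t C D) < (1 - t) * F C + t * F D))"
      by (cases "scalar_matrix (C - D)") (auto simp: less_le)
  qed
  with b have c: "?irr \<longleftrightarrow> (\<forall>C\<in>diagonal_mats n. \<forall>D\<in>diagonal_mats n.
      \<not> scalar_matrix (C - D) \<longrightarrow> (\<forall>t\<in>{0<..<1}. F (mix t C D) < (1 - t) * F C + t * F D))"
    by (rule trans)
  have 1: "\<forall>C\<in>diagonal_mats n. \<forall>D\<in>diagonal_mats n. \<forall>t\<in>{0<..<1}.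
      F (mix t C D) \<le> (1 - t) * F C + t * F D"
    by (intro ballI) (rule convex)
  have 2: "\<forall>C\<in>diagonal_mats n. \<forall>D\<in>diagonal_mats n. \<forall>t\<in>{0<..<1}.
      scalar_matrix (C - D) \<longrightarrow> F (mix t C D) = (1 - t) * F C + t * F D"
    by (intro ballI impI) (rule scalar)
  show ?thesis
    by (rule conjI[OF 1 conjI[OF 2 conjI[OF b c]], unfolded F_def mix_def])
qed

end
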